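(* The capacity region $\mathcal{C}^{f}_{gmac-dms}$ of the two-user Gaussian multiple-access channel with degraded message sets and noiseless feedback described in the context, with power constraints $P_1,P_2>0$ and noise variance $\sigma_1^2>0$, equals the no-feedback capacity region \[ \bigcup_{0\le\rho\le1}\Big\{(R_1\ge0,R_2\ge0):\ R_2\le\tfrac12\log\Big(1+\tfrac{P_2(1-\rho^2)}{\sigma_1^2}\Big),\ R_1+R_2\le\tfrac12\log\Big(1+\tfrac{P_1+P_2+2\sqrt{P_1P_2}\rho}{\sigma_1^2}\Big)\Big\}. \]
   Context: All logarithms are base 2. Channel (GMAC-DMS with feedback): for $i=1,\dots,N$, $Y_i=X_{1,i}+X_{2,i}+\eta_{1,i}$, where $\eta_{1,i}\sim\mathcal N(0,\sigma_1^2)$ are i.i.d. and independent of the messages. Messages $W_1,W_2$ are independent, $W_j$ uniform on $\{1,\dots,|\mathcal W_j|\}$. $X_{1,i}$ is a function of $W_1$ and the noiseless feedback $Y^{i-1}$; $X_{2,i}$ is a function of $W_1$, $W_2$ and $Y^{i-1}$. Power constraints: $\frac1N\sum_{i=1}^N E[X_{j,i}^2]\le P_j$. The receiver outputs $(\hat W_1,\hat W_2)=\psi(Y^N)$; $P_e$ is the average probability that $\psi(Y^N)\neq(W_1,W_2)$. A pair $(R_1,R_2)$ is achievable if for every $\epsilon>0$ and all sufficiently large $N$ there exist encoders and a decoder with $\frac{\log|\mathcal W_j|}{N}=R_j$ ($j=1,2$) and $P_e\le\epsilon$. $\mathcal{C}^{f}_{gmac-dms}$ is the set of all achievable pairs.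
   Formalization: The rate condition log|W_j|/N = R_j, which cannot hold for all large N at generic R_j since |W_j| is an integer, is replaced by log|W_j|/N ≥ R_j − ε (R_j ≥ 0, same ε as for P_e); inputs and decoded messages are required to be measurable in the noise. *)

theory Defs
  imports "HOL-Probability.Probability"
begin

definition noise_space :: "real \<Rightarrow> nat \<Rightarrow> (nat \<Rightarrow> real) measure" where
  "noise_space s N = PiM {..<N} (\<lambda>_. density lborel (normal_density 0 (sqrt s)))"

(* Encoders (time index i = 0..N-1):
   f1 i w1 ys       = X_{1,i}  (ys = past outputs Y_0..Y_{i-1} as a list)
   f2 i w1 w2 ys    = X_{2,i}
   chan_out f1 f2 w1 w2 z i = [Y_0, ..., Y_{i-1}] *)
fun chan_out :: "(nat \<Rightarrow> nat \<Rightarrow> real list \<Rightarrow> real) \<Rightarrow> (nat \<Rightarrow> nat \<Rightarrow> nat \<Rightarrow> real list \<Rightarrow> real)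
    \<Rightarrow> nat \<Rightarrow> nat \<Rightarrow> (nat \<Rightarrow> real) \<Rightarrow> nat \<Rightarrow> real list" where
  "chan_out f1 f2 w1 w2 z 0 = []"
| "chan_out f1 f2 w1 w2 z (Suc i) =
     (let ys = chan_out f1 f2 w1 w2 z i
      in ys @ [f1 i w1 ys + f2 i w1 w2 ys + z i])"

definition X1 where "X1 f1 f2 w1 w2 z i = f1 i w1 (chan_out f1 f2 w1 w2 z i)"
definition X2 where "X2 f1 f2 w1 w2 z i = f2 i w1 w2 (chan_out f1 f2 w1 w2 z i)"

definition fb_code :: "real \<Rightarrow> real \<Rightarrow> real \<Rightarrow> nat \<Rightarrow> nat \<Rightarrow> nat
    \<Rightarrow> (nat \<Rightarrow> nat \<Rightarrow> real list \<Rightarrow> real) \<Rightarrow> (nat \<Rightarrow> nat \<Rightarrow> nat \<Rightarrow> real list \<Rightarrow> real)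
    \<Rightarrow> (real list \<Rightarrow> nat \<times> nat) \<Rightarrow> bool" where
  "fb_code P1 P2 s N M1 M2 f1 f2 psi \<longleftrightarrow>
     M1 \<ge> 1 \<and> M2 \<ge> 1 \<and>
     (\<forall>w1\<in>{1..M1}. \<forall>w2\<in>{1..M2}.
        (\<lambda>z. psi (chan_out f1 f2 w1 w2 z N)) \<in> measurable (noise_space s N) (count_space UNIV) \<and>
        (\<forall>i<N. (\<lambda>z. X1 f1 f2 w1 w2 z i) \<in> borel_measurable (noise_space s N) \<and>
               (\<lambda>z. X2 f1 f2 w1 w2 z i) \<in> borel_measurable (noise_space s N))) \<and>
     (\<Sum>i<N. \<Sum>w1\<in>{1..M1}. \<Sum>w2\<in>{1..M2}.
        \<integral>\<^sup>+ z. ennreal ((X1 f1 f2 w1 w2 z i)\<^sup>2) \<partial>noise_space s N)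
        \<le> ennreal (real N * real M1 * real M2 * P1) \<and>
     (\<Sum>i<N. \<Sum>w1\<in>{1..M1}. \<Sum>w2\<in>{1..M2}.
        \<integral>\<^sup>+ z. ennreal ((X2 f1 f2 w1 w2 z i)\<^sup>2) \<partial>noise_space s N)
        \<le> ennreal (real N * real M1 * real M2 * P2)"

definition err_prob :: "real \<Rightarrow> nat \<Rightarrow> nat \<Rightarrow> nat
    \<Rightarrow> (nat \<Rightarrow> nat \<Rightarrow> real list \<Rightarrow> real) \<Rightarrow> (nat \<Rightarrow> nat \<Rightarrow> nat \<Rightarrow> real list \<Rightarrow> real)
    \<Rightarrow> (real list \<Rightarrow> nat \<times> nat) \<Rightarrow> real" where
  "err_prob s N M1 M2 f1 f2 psi =
     (\<Sum>w1\<in>{1..M1}. \<Sum>w2\<in>{1..M2}.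
        measure (noise_space s N)
          {z \<in> space (noise_space s N). psi (chan_out f1 f2 w1 w2 z N) \<noteq> (w1, w2)})
     / (real M1 * real M2)"

definition achievable_fb :: "real \<Rightarrow> real \<Rightarrow> real \<Rightarrow> real \<times> real \<Rightarrow> bool" where
  "achievable_fb P1 P2 s R \<longleftrightarrow> fst R \<ge> 0 \<and> snd R \<ge> 0 \<and>
     (\<forall>\<epsilon>>0. \<exists>N0. \<forall>N\<ge>N0. N > 0 \<longrightarrow> (\<exists>M1 M2 f1 f2 psi.
        fb_code P1 P2 s N M1 M2 f1 f2 psi \<and>
        log 2 (real M1) / real N \<ge> fst R - \<epsilon> \<and>
        log 2 (real M2) / real N \<ge> snd R - \<epsilon> \<and>
        err_prob s N M1 M2 f1 f2 psi \<le> \<epsilon>))"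

definition capacity_fb_gmac_dms :: "real \<Rightarrow> real \<Rightarrow> real \<Rightarrow> (real \<times> real) set" where
  "capacity_fb_gmac_dms P1 P2 s = {R. achievable_fb P1 P2 s R}"

end

theory Submission
  imports Defs
begin

text \<open>Both halves use second moments only.

Converse. Compare the true output law, given the messages, with a reference law under which the
output letter has conditional density N(mu, tau), where mu does not depend on the messages to be
decoded. With L the log-density of the reference law relative to the true one and G the event of
correct decoding among m messages, 1 + (ln m) 1_G + L <= exp ((ln m) 1_G + L) integrates to at most
2 on average over the messages, because the noise-to-output map is a shear and the decoding regions
are disjoint. Hence (1 - P_e) ln m <= 1 - E L, and E L is a function of second moments. Taking
mu = 0 bounds the sum rate; taking mu = (1 + beta) X_1, with beta X_1 the time-averaged linear
estimate of X_2, bounds R_2. The time-averaged correlation of the inputs supplies rho, and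
compactness of [0,1] handles the limit.

Achievability. Increasing rho keeps the sum-rate bound valid, so one may assume equality in the
bound on R_2. Two Schalkwijk-Kailath schemes are nested: the second user's inner scheme turns its message
signal plus noise into a white sequence of variance Q + s with Q = P_2 (1 - rho^2), and the outer
scheme, carried by both users coherently, treats that sequence as its noise. The mean square errors
decay as (s / (Q + s))^N and ((Q + s) / (a^2 + Q + s))^N, and Chebyshev's inequality suffices for
equally spaced message points.\<close>

subsection \<open>The noise space\<close>

lemma chan_out_cong:
  assumes "\<And>j. j < i \<Longrightarrow> z j = z' j"
  shows "chan_out f1 f2 w1 w2 z i = chan_out f1 f2 w1 w2 z' i"
  using assms by (induction i) (auto simp: Let_def)

lemma
  assumes "s > 0"
  shows prob_space_noise: "prob_space (noise_space s N)"
    and product_prob_noise: "product_prob_space (\<lambda>_::nat. density lborel (normal_density 0 (sqrt s)))"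
proof -
  interpret P: prob_space "density lborel (normal_density 0 (sqrt s))"
    using assms by (intro prob_space_normal_density) simp
  show "product_prob_space (\<lambda>_::nat. density lborel (normal_density 0 (sqrt s)))"
    by (intro product_prob_spaceI) (rule P.prob_space_axioms)
  show "prob_space (noise_space s N)"
    unfolding noise_space_def by (intro prob_space_PiM) (rule P.prob_space_axioms)
qed

lemma sets_noise [measurable_cong]: "sets (noise_space s N) = sets (PiM {..<N} (\<lambda>_. borel))"
  unfolding noise_space_def by (intro sets_PiM_cong) auto

lemma
  assumes s: "s > 0" and i: "i < N"
  shows integrable_noise_square: "integrable (noise_space s N) (\<lambda>z. (z i)\<^sup>2)"
    and integral_noise_square: "(\<integral>z. (z i)\<^sup>2 \<partial>noise_space s N) = s"
proof -
  let ?g = "density lborel (normal_density 0 (sqrt s))"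
  have d: "distr (noise_space s N) ?g (\<lambda>z. z i) = ?g"
    unfolding noise_space_def using i s
    by (intro distr_PiM_component[where M="\<lambda>_. ?g"]) (auto intro: prob_space_normal_density)
  have m: "(\<lambda>z. z i) \<in> measurable (noise_space s N) ?g"
    using i by (simp cong: measurable_cong_sets)
  have hb: "has_bochner_integral lborel (\<lambda>x. normal_density 0 (sqrt s) x * x\<^sup>2) s"
    using normal_moment_even[of "sqrt s" 0 1] s by simp
  then have "has_bochner_integral ?g (\<lambda>x. x\<^sup>2) s"
    by (intro has_bochner_integral_density) auto
  then have "integrable (distr (noise_space s N) ?g (\<lambda>z. z i)) (\<lambda>x. x\<^sup>2)"
    and "(\<integral>x. x\<^sup>2 \<partial>distr (noise_space s N) ?g (\<lambda>z. z i)) = s"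
    unfolding d by (simp_all add: has_bochner_integral_iff)
  then show "integrable (noise_space s N) (\<lambda>z. (z i)\<^sup>2)" "(\<integral>z. (z i)\<^sup>2 \<partial>noise_space s N) = s"
    using m by (simp_all add: integrable_distr_eq integral_distr)
qed

text \<open>Domination by f^2 + g^2 suffices; with it every cross moment of inputs, states and noise
  is available as soon as the squares are integrable.\<close>

lemma integrable_mult_of_squares:
  fixes f g :: "'a \<Rightarrow> real"
  assumes [measurable]: "f \<in> borel_measurable M" "g \<in> borel_measurable M"
    and "integrable M (\<lambda>x. (f x)\<^sup>2)" "integrable M (\<lambda>x. (g x)\<^sup>2)"
  shows "integrable M (\<lambda>x. f x * g x)"
proof (rule Bochner_Integration.integrable_bound)
  show "integrable M (\<lambda>x. (f x)\<^sup>2 + (g x)\<^sup>2)"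
    using assms by simp
  have "\<bar>f x * g x\<bar> \<le> (f x)\<^sup>2 + (g x)\<^sup>2" for x
  proof -
    have "2 * (\<bar>f x\<bar> * \<bar>g x\<bar>) \<le> (f x)\<^sup>2 + (g x)\<^sup>2"
      using sum_squares_bound[of "\<bar>f x\<bar>" "\<bar>g x\<bar>"] by simp
    moreover have "0 \<le> \<bar>f x\<bar> * \<bar>g x\<bar>" by simp
    ultimately show ?thesis unfolding abs_mult by linarith
  qed
  then show "AE x in M. norm (f x * g x) \<le> norm ((f x)\<^sup>2 + (g x)\<^sup>2)"
    by simp
qed simp

text \<open>Causality enters here: \<open>F\<close> does not look at coordinate \<open>i\<close>, so
  by Fubini that coordinate is integrated first and contributes its mean, which is zero. Later
  \<open>F\<close> is an input deviation or a state computed from earlier noise.\<close>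

lemma
  assumes s: "s > 0" and i: "i < N"
    and F[measurable]: "F \<in> borel_measurable (noise_space s N)"
    and sq: "integrable (noise_space s N) (\<lambda>z. (F z)\<^sup>2)"
    and indep: "\<And>z t. F (z(i := t)) = F z"
  shows integrable_mult_noise: "integrable (noise_space s N) (\<lambda>z. F z * z i)"
    and integral_mult_noise: "(\<integral>z. F z * z i \<partial>noise_space s N) = 0"
proof -
  have [measurable]: "(\<lambda>z. z i) \<in> borel_measurable (noise_space s N)"
    using i by (simp cong: measurable_cong_sets)
  show int: "integrable (noise_space s N) (\<lambda>z. F z * z i)"
    by (intro integrable_mult_of_squares sq integrable_noise_square s i) measurable
  let ?g = "density lborel (normal_density 0 (sqrt s))"
  interpret product_prob_space "\<lambda>_::nat. ?g" by (rule product_prob_noise[OF s])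
  have ins: "{..<N} = insert i ({..<N} - {i})" using i by auto
  have z: "(\<integral>y. y \<partial>?g) = 0"
    using integral_normal_moment_nz_1[of "sqrt s" 0] s
    by (subst integral_density) (auto simp: normal_density_nonneg)
  have "(\<integral>z. F z * z i \<partial>noise_space s N)
      = (\<integral>x. (\<integral>y. F (x(i:=y)) * (x(i:=y)) i \<partial>?g) \<partial>PiM ({..<N} - {i}) (\<lambda>_. ?g))"
    unfolding noise_space_def
    by (subst ins, rule product_integral_insert)
       (use int ins in \<open>auto simp: noise_space_def\<close>)
  also have "\<dots> = 0"
    by (simp add: indep z)
  finally show "(\<integral>z. F z * z i \<partial>noise_space s N) = 0" .
qed

subsection \<open>Converse\<close>

text \<open>One message pair is fixed. Each output is its noise plus a function of the earlier
  outputs, so the noise-to-output map is a shear. The past is a restricted function instead of a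
  list, which makes it a point of a product space.\<close>

locale triangular_channel =
  fixes N :: nat and x :: "nat \<Rightarrow> (nat \<Rightarrow> real) \<Rightarrow> real" and Y :: "(nat \<Rightarrow> real) \<Rightarrow> nat \<Rightarrow> real"
  assumes Y_eq: "\<And>z i. Y z i = z i + x i (restrict (Y z) {..<i})"
    and x_measurable: "\<And>i. i < N \<Longrightarrow> x i \<in> borel_measurable (PiM {..<i} (\<lambda>_. borel))"
begin

lemma Y_cong:
  assumes "\<And>j. j \<le> i \<Longrightarrow> z j = z' j"
  shows "Y z i = Y z' i"
  using assms
proof (induction i rule: less_induct)
  case (less i)
  have "restrict (Y z) {..<i} = restrict (Y z') {..<i}"
    using less by (intro restrict_ext) auto
  then show ?case using less.prems by (simp add: Y_eq[of _ i])
qed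

lemma Y_measurable:
  assumes "i < N" "{..i} \<subseteq> I"
  shows "(\<lambda>z. Y z i) \<in> borel_measurable (PiM I (\<lambda>_. borel))"
  using assms
proof (induction i rule: less_induct)
  case (less i)
  have "(\<lambda>z. restrict (Y z) {..<i}) \<in> measurable (PiM I (\<lambda>_. borel)) (PiM {..<i} (\<lambda>_. borel))"
    using less by (intro measurable_restrict less.IH) (auto simp: subset_iff)
  note [measurable] = measurable_compose[OF this x_measurable[OF less.prems(1)]]
  have [measurable]: "(\<lambda>z. z i) \<in> borel_measurable (PiM I (\<lambda>_. borel))"
    using less.prems by (intro measurable_component_singleton) auto
  show ?case unfolding Y_eq[of _ i] by measurable
qed

lemma restrict_Y_measurable:
  assumes "n \<le> N" "{..<n} \<subseteq> I"
  shows "(\<lambda>z. restrict (Y z) {..<n}) \<in> measurable (PiM I (\<lambda>_. borel)) (PiM {..<n} (\<lambda>_. borel))"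
  using assms by (intro measurable_restrict Y_measurable) auto

text \<open>Dividing by the noise density turns the Gaussian product into Lebesgue measure, and a
  shear preserves Lebesgue measure. The last noise coordinate is integrated first: with the past
  fixed it only translates the last output.\<close>

lemma nn_integral_output:
  assumes s: "s > 0" and "n \<le> N" and "H \<in> borel_measurable (PiM {..<n} (\<lambda>_. borel))"
  shows "(\<integral>\<^sup>+z. H (restrict (Y z) {..<n}) * (\<Prod>i<n. ennreal (1 / normal_density 0 (sqrt s) (z i))) \<partial>noise_space s n)
    = (\<integral>\<^sup>+y. H y \<partial>PiM {..<n} (\<lambda>_. lborel))"
  using assms(2,3)
\<comment> \<open>\<open>H\<close> is generalized because the induction hypothesis is applied to
  \<open>H\<close> with its last output already integrated out.\<close>
proof (induction n arbitrary: H)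
  case 0
  show ?case
    by (simp add: noise_space_def PiM_empty nn_integral_count_space_finite restrict_def)
next
  case (Suc n)
  note [measurable] = Suc.prems(2)
  let ?\<phi> = "normal_density 0 (sqrt s)"
  let ?g = "density lborel ?\<phi>"
  interpret G: product_prob_space "\<lambda>_::nat. ?g" by (rule product_prob_noise[OF s])
  interpret L: product_sigma_finite "\<lambda>_::nat. lborel :: real measure" by standard
  have pos: "?\<phi> t > 0" for t using s by (simp add: normal_density_pos)
  have Hm[measurable]: "H \<in> borel_measurable (PiM (insert n {..<n}) (\<lambda>_. borel))"
    using Suc.prems(2) by (simp add: lessThan_Suc)
  have Ym[measurable]: "(\<lambda>z. restrict (Y z) {..<Suc n}) \<in> measurable (PiM {..<Suc n} (\<lambda>_. borel)) (PiM {..<Suc n} (\<lambda>_. borel))"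
    by (rule restrict_Y_measurable[OF Suc.prems(1) order_refl])
  \<comment> \<open>Noise \<open>n\<close> reaches no output before time \<open>n\<close>, and
    output \<open>n\<close> is that noise shifted by a function of the earlier outputs.\<close>
  have upd: "restrict (Y (w(n:=t))) {..<Suc n} = (restrict (Y w) {..<n})(n := t + x n (restrict (Y w) {..<n}))" for w t
  proof -
    have "restrict (Y (w(n:=t))) {..<n} = restrict (Y w) {..<n}"
      by (intro restrict_ext Y_cong) auto
    then have "Y (w(n:=t)) n = t + x n (restrict (Y w) {..<n})"
      by (simp add: Y_eq[of _ n])
    moreover have "Y (w(n:=t)) i = Y w i" if "i < n" for i
      using that by (intro Y_cong) auto
    ultimately show ?thesis by (auto simp: fun_eq_iff restrict_def less_Suc_eq)
  qed
  have Hu[measurable]: "(\<lambda>t. H (y(n:=t))) \<in> borel_measurable borel" if "y \<in> space (PiM {..<n} (\<lambda>_. borel))" for y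
    by (rule measurable_compose[OF measurable_component_update[OF that] Hm]) simp
  \<comment> \<open>The density cancels against its reciprocal, and the shift \<open>c\<close>
    disappears by translation invariance.\<close>
  have inner: "(\<integral>\<^sup>+t. H (y(n := t + c)) * ennreal (1 / ?\<phi> t) \<partial>?g) = (\<integral>\<^sup>+t. H (y(n:=t)) \<partial>lborel)"
    if y: "y \<in> space (PiM {..<n} (\<lambda>_. borel))" for y c
  proof -
    note [measurable] = Hu[OF y]
    have [measurable]: "(\<lambda>t. H (y(n:=t+c))) \<in> borel_measurable borel"
      by (rule measurable_compose[OF _ Hu[OF y], of "\<lambda>t. t + c"]) simp
    have "(\<integral>\<^sup>+t. H (y(n := t + c)) * ennreal (1 / ?\<phi> t) \<partial>?g)
       = (\<integral>\<^sup>+t. ennreal (?\<phi> t) * (H (y(n := t + c)) * ennreal (1 / ?\<phi> t)) \<partial>lborel)"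
      by (subst nn_integral_density) auto
    also have "\<dots> = (\<integral>\<^sup>+t. H (y(n := c + 1 * t)) \<partial>lborel)"
    proof (intro nn_integral_cong)
      fix t
      have "ennreal (?\<phi> t) * ennreal (1 / ?\<phi> t) = 1"
        using pos[of t] by (simp flip: ennreal_mult)
      then show "ennreal (?\<phi> t) * (H (y(n := t + c)) * ennreal (1 / ?\<phi> t)) = H (y(n := c + 1 * t))"
        by (metis mult.commute mult.left_commute mult_1 add.commute)
    qed
    also have "\<dots> = (\<integral>\<^sup>+t. H (y(n:=t)) \<partial>lborel)"
      by (subst nn_integral_real_affine[where c=1 and t=c]) auto
    finally show ?thesis .
  qed
  have "(\<integral>\<^sup>+z. H (restrict (Y z) {..<Suc n}) * (\<Prod>i<Suc n. ennreal (1 / ?\<phi> (z i))) \<partial>noise_space s (Suc n))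
      = (\<integral>\<^sup>+w. (\<integral>\<^sup>+t. H (restrict (Y (w(n:=t))) {..<Suc n}) * (\<Prod>i<Suc n. ennreal (1 / ?\<phi> ((w(n:=t)) i))) \<partial>?g) \<partial>noise_space s n)"
  proof -
    have "(\<lambda>z. H (restrict (Y z) {..<Suc n}) * (\<Prod>i<Suc n. ennreal (1 / ?\<phi> (z i)))) \<in> borel_measurable (PiM {..<Suc n} (\<lambda>_. borel))"
      by measurable
    then have "(\<lambda>z. H (restrict (Y z) {..<Suc n}) * (\<Prod>i<Suc n. ennreal (1 / ?\<phi> (z i)))) \<in> borel_measurable (noise_space s (Suc n))"
      by (simp cong: measurable_cong_sets add: sets_noise)
    then show ?thesis
      unfolding noise_space_def lessThan_Suc
      by (intro G.product_nn_integral_insert) auto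
  qed
  also have "\<dots> = (\<integral>\<^sup>+w. (\<integral>\<^sup>+t. H ((restrict (Y w) {..<n})(n:=t)) \<partial>lborel) * (\<Prod>i<n. ennreal (1 / ?\<phi> (w i))) \<partial>noise_space s n)"
  proof (intro nn_integral_cong)
    fix w
    let ?y = "restrict (Y w) {..<n}"
    let ?P = "\<Prod>i<n. ennreal (1 / ?\<phi> (w i))"
    have y: "?y \<in> space (PiM {..<n} (\<lambda>_. borel))" by (auto simp: space_PiM)
    have [measurable]: "(\<lambda>t. H (?y(n:=t+c))) \<in> borel_measurable borel" for c
      by (rule measurable_compose[OF _ Hu[OF y], of "\<lambda>t. t + c"]) simp
    have "(\<integral>\<^sup>+t. H (restrict (Y (w(n:=t))) {..<Suc n}) * (\<Prod>i<Suc n. ennreal (1 / ?\<phi> ((w(n:=t)) i))) \<partial>?g)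
       = (\<integral>\<^sup>+t. H (?y(n := t + x n ?y)) * ennreal (1 / ?\<phi> t) * ?P \<partial>?g)"
    proof (intro nn_integral_cong)
      fix t
      have "(\<Prod>i<n. ennreal (1 / ?\<phi> ((w(n:=t)) i))) = ?P"
        by (intro prod.cong) auto
      then show "H (restrict (Y (w(n:=t))) {..<Suc n}) * (\<Prod>i<Suc n. ennreal (1 / ?\<phi> ((w(n:=t)) i)))
          = H (?y(n := t + x n ?y)) * ennreal (1 / ?\<phi> t) * ?P"
        unfolding upd prod.lessThan_Suc by (simp add: mult_ac)
    qed
    also have "\<dots> = (\<integral>\<^sup>+t. H (?y(n := t + x n ?y)) * ennreal (1 / ?\<phi> t) \<partial>?g) * ?P"
      by (intro nn_integral_multc) measurable
    also have "\<dots> = (\<integral>\<^sup>+t. H (?y(n:=t)) \<partial>lborel) * ?P"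
      by (simp only: inner[OF y])
    finally show "(\<integral>\<^sup>+t. H (restrict (Y (w(n:=t))) {..<Suc n}) * (\<Prod>i<Suc n. ennreal (1 / ?\<phi> ((w(n:=t)) i))) \<partial>?g)
       = (\<integral>\<^sup>+t. H (?y(n:=t)) \<partial>lborel) * ?P" .
  qed
  also have "\<dots> = (\<integral>\<^sup>+y. (\<integral>\<^sup>+t. H (y(n:=t)) \<partial>lborel) \<partial>PiM {..<n} (\<lambda>_. lborel))"
    using Suc.prems(1) by (intro Suc.IH) measurable
  also have "\<dots> = (\<integral>\<^sup>+y. H y \<partial>PiM {..<Suc n} (\<lambda>_. lborel))"
    unfolding lessThan_Suc
    by (subst L.product_nn_integral_insert) (auto cong: measurable_cong_sets sets_PiM_cong)
  finally show ?case .
qed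

end

section \<open>Gaussian reference laws and the information bound\<close>

lemma reference_density_measurable:
  fixes \<mu> :: "nat \<Rightarrow> (nat \<Rightarrow> real) \<Rightarrow> real"
  assumes \<mu>: "\<And>i. i < n \<Longrightarrow> \<mu> i \<in> borel_measurable (PiM {..<i} (\<lambda>_. borel))"
  shows "(\<lambda>y. \<Prod>i<n. ennreal (normal_density (\<mu> i (restrict y {..<i})) \<sigma> (y i))) \<in> borel_measurable (PiM {..<n} (\<lambda>_. borel))"
proof -
  have "(\<lambda>y. normal_density (\<mu> i (restrict y {..<i})) \<sigma> (y i)) \<in> borel_measurable (PiM {..<n} (\<lambda>_. borel))"
    if i: "i < n" for i
  proof -
    have "(\<lambda>y. restrict y {..<i}) \<in> measurable (PiM {..<n} (\<lambda>_. borel)) (PiM {..<i} (\<lambda>_. borel))"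
      using i by (intro measurable_restrict_subset) auto
    note [measurable] = measurable_compose[OF this \<mu>[OF i]]
    have [measurable]: "(\<lambda>y. y i) \<in> borel_measurable (PiM {..<n} (\<lambda>_. borel))"
      using i by (intro measurable_component_singleton) auto
    show ?thesis unfolding normal_density_def by measurable
  qed
  then show ?thesis
    by (intro borel_measurable_prod_ennreal measurable_compose[OF _ measurable_ennreal]) auto
qed

text \<open>Given the earlier outputs, each factor is a probability density in its own variable, so
  integrating out the last coordinate removes one factor and leaves the same product for
  \<open>n\<close>.\<close>

lemma nn_integral_reference_density:
  fixes \<mu> :: "nat \<Rightarrow> (nat \<Rightarrow> real) \<Rightarrow> real"
  assumes \<sigma>: "\<sigma> > 0"
    and "\<And>i. i < n \<Longrightarrow> \<mu> i \<in> borel_measurable (PiM {..<i} (\<lambda>_. borel))"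
  shows "(\<integral>\<^sup>+y. (\<Prod>i<n. ennreal (normal_density (\<mu> i (restrict y {..<i})) \<sigma> (y i))) \<partial>PiM {..<n} (\<lambda>_. lborel)) = 1"
  using assms(2)
proof (induction n)
  case 0
  show ?case by (simp add: PiM_empty)
next
  case (Suc n)
  let ?q = "\<lambda>i y. ennreal (normal_density (\<mu> i (restrict y {..<i})) \<sigma> (y i))"
  interpret L: product_sigma_finite "\<lambda>_::nat. lborel :: real measure" by standard
  have "(\<integral>\<^sup>+y. (\<Prod>i<Suc n. ?q i y) \<partial>PiM {..<Suc n} (\<lambda>_. lborel))
    = (\<integral>\<^sup>+y. (\<integral>\<^sup>+t. (\<Prod>i<Suc n. ?q i (y(n:=t))) \<partial>lborel) \<partial>PiM {..<n} (\<lambda>_. lborel))"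
    using reference_density_measurable[of "Suc n" \<mu> \<sigma>, OF Suc.prems] unfolding lessThan_Suc
    by (intro L.product_nn_integral_insert) (auto cong: measurable_cong_sets sets_PiM_cong)
  also have "\<dots> = (\<integral>\<^sup>+y. (\<Prod>i<n. ?q i y) \<partial>PiM {..<n} (\<lambda>_. lborel))"
  proof (intro nn_integral_cong)
    fix y :: "nat \<Rightarrow> real"
    have r: "restrict (y(n:=t)) {..<i} = restrict y {..<i}" if "i \<le> n" for i t
      using that by (auto simp: restrict_def)
    interpret P: prob_space "density lborel (normal_density (\<mu> n (restrict y {..<n})) \<sigma>)"
      using \<sigma> by (intro prob_space_normal_density) simp
    have "(\<integral>\<^sup>+t. ennreal (normal_density (\<mu> n (restrict y {..<n})) \<sigma> t) \<partial>lborel) = 1"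
      using P.emeasure_space_1 by (simp add: emeasure_density)
    moreover have "(\<Prod>i<Suc n. ?q i (y(n:=t))) = ennreal (normal_density (\<mu> n (restrict y {..<n})) \<sigma> t) * (\<Prod>i<n. ?q i y)" for t
    proof -
      have "(\<Prod>i<n. ?q i (y(n:=t))) = (\<Prod>i<n. ?q i y)"
        by (intro prod.cong) (auto simp: r)
      then show ?thesis unfolding prod.lessThan_Suc by (simp add: r mult.commute)
    qed
    ultimately show "(\<integral>\<^sup>+t. (\<Prod>i<Suc n. ?q i (y(n:=t))) \<partial>lborel) = (\<Prod>i<n. ?q i y)"
      by (simp add: nn_integral_multc)
  qed
  also have "\<dots> = 1" by (rule Suc.IH) (simp add: Suc.prems)
  finally show ?case .
qed

text \<open>The likelihood ratio of one letter. The true density of an output given the past is the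
  noise density at \<open>z\<close>; dividing by it leaves an exponent quadratic in
  \<open>y - m\<close> and \<open>z\<close>, whose expectation needs second moments alone.\<close>

lemma normal_density_ratio:
  assumes "s > 0" "\<tau> > 0"
  shows "normal_density m (sqrt \<tau>) y / normal_density 0 (sqrt s) z
    = exp (- (ln (\<tau> / s) / 2) - (y - m)\<^sup>2 / (2 * \<tau>) + z\<^sup>2 / (2 * s))"
proof -
  have "exp (- (ln (\<tau> / s) / 2)) = sqrt (2 * pi * s) / sqrt (2 * pi * \<tau>)"
    using assms by (simp add: exp_minus ln_sqrt[symmetric] real_sqrt_divide real_sqrt_mult)
  moreover have "exp (a - b + c) = exp a * exp (- b) * exp c" for a b c :: real
    by (simp flip: exp_add)
  ultimately have "exp (- (ln (\<tau> / s) / 2) - (y - m)\<^sup>2 / (2 * \<tau>) + z\<^sup>2 / (2 * s))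
     = sqrt (2 * pi * s) / sqrt (2 * pi * \<tau>) * exp (- ((y - m)\<^sup>2 / (2 * \<tau>))) * exp (z\<^sup>2 / (2 * s))"
    by simp
  then show ?thesis
    using assms by (simp add: normal_density_def exp_minus field_simps)
qed

text \<open>The inequality for a single message: \<open>A\<close> is its decoding region,
  \<open>c\<close> the number of messages, \<open>\<mu>\<close> the conditional mean of the
  reference law. On the right stand \<open>c\<close> times the reference probability of
  \<open>A\<close> and minus the expected log-likelihood ratio.\<close>

lemma (in triangular_channel) information_bound:
  fixes \<mu> :: "nat \<Rightarrow> (nat \<Rightarrow> real) \<Rightarrow> real" and s \<tau> c :: real
  defines "\<Delta> \<equiv> \<lambda>i z. x i (restrict (Y z) {..<i}) - \<mu> i (restrict (Y z) {..<i})"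
  assumes s: "s > 0" and \<tau>: "\<tau> > 0" and c: "c \<ge> 1"
    and \<mu>: "\<And>i. i < N \<Longrightarrow> \<mu> i \<in> borel_measurable (PiM {..<i} (\<lambda>_. borel))"
    and A[measurable]: "A \<in> sets (PiM {..<N} (\<lambda>_. borel))"
    and sq: "\<And>i. i < N \<Longrightarrow> integrable (noise_space s N) (\<lambda>z. (\<Delta> i z)\<^sup>2)"
  shows "ln c * measure (noise_space s N) {z \<in> space (noise_space s N). restrict (Y z) {..<N} \<in> A}
    \<le> c * enn2real (\<integral>\<^sup>+y. indicator A y * (\<Prod>i<N. ennreal (normal_density (\<mu> i (restrict y {..<i})) (sqrt \<tau>) (y i))) \<partial>PiM {..<N} (\<lambda>_. lborel))
      + (\<Sum>i<N. ln (\<tau> / s) / 2 + ((\<integral>z. (\<Delta> i z)\<^sup>2 \<partial>noise_space s N) + s) / (2 * \<tau>) - 1 / 2)"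
proof -
  let ?M = "noise_space s N"
  interpret prob_space ?M by (rule prob_space_noise[OF s])
  define q where "q = (\<lambda>y. \<Prod>i<N. ennreal (normal_density (\<mu> i (restrict y {..<i})) (sqrt \<tau>) (y i)))"
  \<comment> \<open>The log-likelihood ratio of letter \<open>i\<close>, with output minus reference
    mean rewritten as \<open>\<Delta> i z + z i\<close>.\<close>
  define l where "l = (\<lambda>i z. - (ln (\<tau> / s) / 2) - (\<Delta> i z + z i)\<^sup>2 / (2 * \<tau>) + (z i)\<^sup>2 / (2 * s))"
  define L where "L = (\<lambda>z. \<Sum>i<N. l i z)"
  have q_app: "(\<Prod>i<N. ennreal (normal_density (\<mu> i (restrict y {..<i})) (sqrt \<tau>) (y i))) = q y" for y
    by (simp only: q_def)
  have q[measurable]: "q \<in> borel_measurable (PiM {..<N} (\<lambda>_. borel))"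
    unfolding q_def by (rule reference_density_measurable) (rule \<mu>)
  have q1: "(\<integral>\<^sup>+y. q y \<partial>PiM {..<N} (\<lambda>_. lborel)) = 1"
    unfolding q_def using \<tau> by (intro nn_integral_reference_density \<mu>) auto
  have z_meas[measurable]: "(\<lambda>z. z i) \<in> borel_measurable ?M" if "i < N" for i
    using that by (simp cong: measurable_cong_sets)
  have Ym[measurable]: "(\<lambda>z. restrict (Y z) {..<i}) \<in> measurable ?M (PiM {..<i} (\<lambda>_. borel))" if "i \<le> N" for i
    using that unfolding measurable_cong_sets[OF sets_noise refl]
    by (intro restrict_Y_measurable) auto
  have \<Delta>_meas[measurable]: "\<Delta> i \<in> borel_measurable ?M" if i: "i < N" for i
  proof -
    have "i \<le> N" using i by simp
    note [measurable] = Ym[OF this] \<mu>[OF i] x_measurable[OF i]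
    show ?thesis unfolding \<Delta>_def by measurable
  qed
  have \<Delta>_indep: "\<Delta> i (z(i := t)) = \<Delta> i z" for i z t
  proof -
    have "restrict (Y (z(i := t))) {..<i} = restrict (Y z) {..<i}"
      by (intro restrict_ext Y_cong) auto
    then show ?thesis by (simp add: \<Delta>_def)
  qed
  \<comment> \<open>\<open>\<Delta> i\<close> depends on earlier noise only, so its product with
    \<open>z i\<close> integrates to zero; the noise variance \<open>s\<close> turns the last term
    into 1/2.\<close>
  have l_int: "has_bochner_integral ?M (l i) (- (ln (\<tau> / s) / 2 + ((\<integral>z. (\<Delta> i z)\<^sup>2 \<partial>?M) + s) / (2 * \<tau>) - 1 / 2))"
    if i: "i < N" for i
  proof -
    note int = sq[OF i] integrable_noise_square[OF s i]
      integrable_mult_noise[OF s i \<Delta>_meas[OF i] sq[OF i] \<Delta>_indep]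
    have eq: "l i = (\<lambda>z. - (ln (\<tau> / s) / 2) - ((\<Delta> i z)\<^sup>2 + 2 * (\<Delta> i z * z i) + (z i)\<^sup>2) / (2 * \<tau>) + (z i)\<^sup>2 / (2 * s))"
      by (simp add: l_def power2_sum mult_ac fun_eq_iff add_ac)
    show ?thesis
      unfolding has_bochner_integral_iff eq
      using int s
      by (simp add: integral_noise_square[OF s i] prob_space
          integral_mult_noise[OF s i \<Delta>_meas[OF i] sq[OF i] \<Delta>_indep])
  qed
  have L_int: "has_bochner_integral ?M L (- (\<Sum>i<N. ln (\<tau> / s) / 2 + ((\<integral>z. (\<Delta> i z)\<^sup>2 \<partial>?M) + s) / (2 * \<tau>) - 1 / 2))"
    unfolding L_def sum_negf[symmetric] using l_int by (intro has_bochner_integral_sum) auto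
  then have [measurable]: "L \<in> borel_measurable ?M"
    by (auto simp: has_bochner_integral_iff)
  \<comment> \<open>Weighting the noise law by \<open>exp (L z)\<close> gives the output exactly the
    reference density \<open>q\<close>.\<close>
  have change: "(\<integral>\<^sup>+z. ennreal (indicator B (restrict (Y z) {..<N}) * exp (L z)) \<partial>?M)
      = (\<integral>\<^sup>+y. indicator B y * q y \<partial>PiM {..<N} (\<lambda>_. lborel))"
    if [measurable]: "B \<in> sets (PiM {..<N} (\<lambda>_. borel))" for B
  proof -
    have "(\<integral>\<^sup>+z. ennreal (indicator B (restrict (Y z) {..<N}) * exp (L z)) \<partial>?M)
      = (\<integral>\<^sup>+z. (indicator B (restrict (Y z) {..<N}) * q (restrict (Y z) {..<N})) * (\<Prod>i<N. ennreal (1 / normal_density 0 (sqrt s) (z i))) \<partial>?M)"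
    proof (intro nn_integral_cong)
      fix z
      have "ennreal (normal_density (\<mu> i (restrict (restrict (Y z) {..<N}) {..<i})) (sqrt \<tau>) (restrict (Y z) {..<N} i))
          * ennreal (1 / normal_density 0 (sqrt s) (z i)) = ennreal (exp (l i z))" if i: "i < N" for i
      proof -
        have r: "restrict (restrict (Y z) {..<N}) {..<i} = restrict (Y z) {..<i}"
          using i by (auto simp: restrict_def)
        have "Y z i - \<mu> i (restrict (Y z) {..<i}) = \<Delta> i z + z i"
          unfolding \<Delta>_def by (subst Y_eq) simp
        then have "normal_density (\<mu> i (restrict (Y z) {..<i})) (sqrt \<tau>) (Y z i) / normal_density 0 (sqrt s) (z i) = exp (l i z)"
          by (simp add: normal_density_ratio[OF s \<tau>] l_def)
        then show ?thesis
          unfolding r using i by (simp flip: ennreal_mult)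
      qed
      then have "q (restrict (Y z) {..<N}) * (\<Prod>i<N. ennreal (1 / normal_density 0 (sqrt s) (z i))) = ennreal (exp (L z))"
        unfolding q_def L_def prod.distrib[symmetric] exp_sum[OF finite_lessThan]
        by (subst prod_ennreal[symmetric]) (auto intro!: prod.cong)
      then show "ennreal (indicator B (restrict (Y z) {..<N}) * exp (L z))
        = (indicator B (restrict (Y z) {..<N}) * q (restrict (Y z) {..<N})) * (\<Prod>i<N. ennreal (1 / normal_density 0 (sqrt s) (z i)))"
        by (auto simp: indicator_def mult.assoc)
    qed
    also have "\<dots> = (\<integral>\<^sup>+y. indicator B y * q y \<partial>PiM {..<N} (\<lambda>_. lborel))"
      using nn_integral_output[OF s order_refl, of "\<lambda>y. indicator B y * q y"] by simp
    finally show ?thesis .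
  qed
  define I where "I = (\<lambda>z. indicator A (restrict (Y z) {..<N}) :: real)"
  have [measurable]: "(\<lambda>z. restrict (Y z) {..<N}) \<in> measurable ?M (PiM {..<N} (\<lambda>_. borel))"
    by (rule Ym) simp
  have [measurable]: "I \<in> borel_measurable ?M" unfolding I_def by measurable
  have e1: "(\<integral>\<^sup>+z. ennreal (exp (L z)) \<partial>?M) = 1"
  proof -
    have "(\<integral>\<^sup>+z. ennreal (exp (L z)) \<partial>?M)
       = (\<integral>\<^sup>+z. ennreal (indicator (space (PiM {..<N} (\<lambda>_. borel :: real measure))) (restrict (Y z) {..<N}) * exp (L z)) \<partial>?M)"
      by (intro nn_integral_cong) (simp add: space_PiM)
    also have "\<dots> = (\<integral>\<^sup>+y. indicator (space (PiM {..<N} (\<lambda>_. borel :: real measure))) y * q y \<partial>PiM {..<N} (\<lambda>_. lborel))"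
      by (rule change) simp
    also have "\<dots> = (\<integral>\<^sup>+y. q y \<partial>PiM {..<N} (\<lambda>_. lborel))"
      by (intro nn_integral_cong) (auto simp: space_PiM)
    finally show ?thesis by (simp add: q1)
  qed
  have eA: "(\<integral>\<^sup>+z. ennreal (I z * exp (L z)) \<partial>?M) = (\<integral>\<^sup>+y. indicator A y * q y \<partial>PiM {..<N} (\<lambda>_. lborel))"
    unfolding I_def by (rule change) (rule A)
  have int1: "integrable ?M (\<lambda>z. exp (L z))" "(\<integral>z. exp (L z) \<partial>?M) = 1"
    using e1 by (auto intro!: integrableI_nonneg simp: integral_eq_nn_integral)
  have intA: "integrable ?M (\<lambda>z. I z * exp (L z))"
    by (rule Bochner_Integration.integrable_bound[OF int1(1)]) (auto simp: I_def indicator_def)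
  have EA: "(\<integral>z. I z * exp (L z) \<partial>?M) = enn2real (\<integral>\<^sup>+y. indicator A y * q y \<partial>PiM {..<N} (\<lambda>_. lborel))"
    unfolding eA[symmetric] by (intro integral_eq_nn_integral) (auto simp: I_def)
  have intI: "integrable ?M I"
    by (rule integrable_const_bound[of _ 1]) (auto simp: I_def)
  have EI: "(\<integral>z. I z \<partial>?M) = measure ?M {z \<in> space ?M. restrict (Y z) {..<N} \<in> A}"
  proof -
    have "(\<integral>z. I z \<partial>?M) = (\<integral>z. indicator {z \<in> space ?M. restrict (Y z) {..<N} \<in> A} z \<partial>?M)"
      by (intro Bochner_Integration.integral_cong) (auto simp: I_def indicator_def)
    also have "\<dots> = measure ?M {z \<in> space ?M. restrict (Y z) {..<N} \<in> A}" by simp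
    finally show ?thesis .
  qed
  have "1 + ln c * I z + L z \<le> c * (I z * exp (L z)) + exp (L z)" for z
  proof -
    have "1 + (ln c * I z + L z) \<le> exp (ln c * I z + L z)" by (rule exp_ge_add_one_self)
    \<comment> \<open>\<open>exp (ln c * I z)\<close> is \<open>c\<close> on correct decoding and 1
      elsewhere, hence at most \<open>c * I z + 1\<close>.\<close>
    also have "\<dots> \<le> c * (I z * exp (L z)) + exp (L z)"
      using c by (auto simp: I_def indicator_def exp_add)
    finally show ?thesis by (simp add: add_ac)
  qed
  then have "(\<integral>z. 1 + ln c * I z + L z \<partial>?M) \<le> (\<integral>z. c * (I z * exp (L z)) + exp (L z) \<partial>?M)"
    using intA int1 intI L_int by (intro integral_mono) (auto simp: has_bochner_integral_iff)
  moreover have "(\<integral>z. c * (I z * exp (L z)) + exp (L z) \<partial>?M) = c * (\<integral>z. I z * exp (L z) \<partial>?M) + 1"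
    using intA int1 by simp
  moreover have "(\<integral>z. 1 + ln c * I z + L z \<partial>?M) = 1 + ln c * (\<integral>z. I z \<partial>?M) + (\<integral>z. L z \<partial>?M)"
    using intI L_int by (simp add: has_bochner_integral_iff prob_space)
  ultimately show ?thesis
    using L_int unfolding q_app EA EI has_bochner_integral_iff by linarith
qed

text \<open>The mean \<open>\<mu>\<close> is common to all messages in \<open>W\<close>, so there is
  a single reference law and its masses on the disjoint decoding regions add up to at most 1.
  Summing the per-message bound with \<open>c = card W\<close> then costs only the additive
  \<open>card W\<close>.\<close>

lemma fano_inequality:
  fixes \<mu> :: "nat \<Rightarrow> (nat \<Rightarrow> real) \<Rightarrow> real" and s \<tau> :: real
    and x :: "'w \<Rightarrow> nat \<Rightarrow> (nat \<Rightarrow> real) \<Rightarrow> real" and Y :: "'w \<Rightarrow> (nat \<Rightarrow> real) \<Rightarrow> nat \<Rightarrow> real"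
  defines "\<Delta> \<equiv> \<lambda>w i z. x w i (restrict (Y w z) {..<i}) - \<mu> i (restrict (Y w z) {..<i})"
  assumes s: "s > 0" and \<tau>: "\<tau> > 0" and W: "finite W" "W \<noteq> {}"
    and chan: "\<And>w. w \<in> W \<Longrightarrow> triangular_channel N (x w) (Y w)"
    and \<mu>: "\<And>i. i < N \<Longrightarrow> \<mu> i \<in> borel_measurable (PiM {..<i} (\<lambda>_. borel))"
    and dec[measurable]: "dec \<in> measurable (PiM {..<N} (\<lambda>_. borel)) (count_space UNIV)"
    and sq: "\<And>w i. w \<in> W \<Longrightarrow> i < N \<Longrightarrow> integrable (noise_space s N) (\<lambda>z. (\<Delta> w i z)\<^sup>2)"
  shows "ln (card W) * (\<Sum>w\<in>W. measure (noise_space s N) {z \<in> space (noise_space s N). dec (restrict (Y w z) {..<N}) = w})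
    \<le> card W + (\<Sum>w\<in>W. \<Sum>i<N. ln (\<tau> / s) / 2 + ((\<integral>z. (\<Delta> w i z)\<^sup>2 \<partial>noise_space s N) + s) / (2 * \<tau>) - 1 / 2)"
proof -
  let ?L = "PiM {..<N} (\<lambda>_. lborel :: real measure)"
  define q where "q = (\<lambda>y. \<Prod>i<N. ennreal (normal_density (\<mu> i (restrict y {..<i})) (sqrt \<tau>) (y i)))"
  define A where "A = (\<lambda>w. {y \<in> space (PiM {..<N} (\<lambda>_. borel :: real measure)). dec y = w})"
  define a where "a = (\<lambda>w. \<integral>\<^sup>+y. indicator (A w) y * q y \<partial>?L)"
  have A[measurable]: "A w \<in> sets (PiM {..<N} (\<lambda>_. borel))" for w
    unfolding A_def by measurable
  have [measurable]: "q \<in> borel_measurable (PiM {..<N} (\<lambda>_. borel))"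
    unfolding q_def by (rule reference_density_measurable) (rule \<mu>)
  have q1: "(\<integral>\<^sup>+y. q y \<partial>?L) = 1"
    unfolding q_def using \<tau> by (intro nn_integral_reference_density \<mu>) auto
  have sL: "sets ?L = sets (PiM {..<N} (\<lambda>_. borel))" by (intro sets_PiM_cong) auto
  have m: "(\<lambda>y. indicator (A w) y * q y) \<in> borel_measurable ?L" for w
    unfolding measurable_cong_sets[OF sL refl] by measurable
  have a_sum: "(\<Sum>w\<in>W. a w) \<le> 1"
  proof -
    have "(\<Sum>w\<in>W. a w) = (\<integral>\<^sup>+y. (\<Sum>w\<in>W. indicator (A w) y * q y) \<partial>?L)"
      unfolding a_def using m by (intro nn_integral_sum[symmetric])
    also have "\<dots> \<le> (\<integral>\<^sup>+y. q y \<partial>?L)"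
    proof (intro nn_integral_mono)
      fix y
      \<comment> \<open>At each \<open>y\<close> at most one region counts, that of
        \<open>dec y\<close>, and none if \<open>dec y\<close> lies outside
        \<open>W\<close>.\<close>
      have "(\<Sum>w\<in>W. indicator (A w) y * q y) \<le> (\<Sum>w\<in>W. if w = dec y then q y else 0)"
        by (intro sum_mono) (auto simp: indicator_def A_def)
      also have "\<dots> \<le> q y" using W by simp
      finally show "(\<Sum>w\<in>W. indicator (A w) y * q y) \<le> q y" .
    qed
    finally show ?thesis by (simp add: q1)
  qed
  have a_real: "(\<Sum>w\<in>W. enn2real (a w)) \<le> 1"
  proof -
    have "a w \<le> 1" if "w \<in> W" for w
      by (rule order_trans[OF member_le_sum a_sum]) (use that W in auto)
    then have "a w < \<top>" if "w \<in> W" for w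
      using that by (metis ennreal_one_less_top order_le_less_trans)
    then have "(\<Sum>w\<in>W. enn2real (a w)) = enn2real (\<Sum>w\<in>W. a w)"
      by (subst enn2real_sum) (auto simp: o_def)
    also have "\<dots> \<le> enn2real 1" using a_sum by (intro enn2real_mono) auto
    finally show ?thesis by simp
  qed
  have c: "real (card W) \<ge> 1" using W by (simp add: Suc_le_eq card_gt_0_iff)
  let ?I = "\<lambda>w. \<Sum>i<N. ln (\<tau> / s) / 2 + ((\<integral>z. (\<Delta> w i z)\<^sup>2 \<partial>noise_space s N) + s) / (2 * \<tau>) - 1 / 2"
  have bound: "ln (card W) * measure (noise_space s N) {z \<in> space (noise_space s N). dec (restrict (Y w z) {..<N}) = w}
     \<le> card W * enn2real (a w) + ?I w" if w: "w \<in> W" for w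
  proof -
    interpret triangular_channel N "x w" "Y w" by (rule chan[OF w])
    have "{z \<in> space (noise_space s N). dec (restrict (Y w z) {..<N}) = w}
      = {z \<in> space (noise_space s N). restrict (Y w z) {..<N} \<in> A w}"
      by (auto simp: A_def space_PiM)
    then show ?thesis
      using information_bound[OF s \<tau> c \<mu> A] sq[OF w] unfolding \<Delta>_def a_def q_def by simp
  qed
  have "ln (card W) * (\<Sum>w\<in>W. measure (noise_space s N) {z \<in> space (noise_space s N). dec (restrict (Y w z) {..<N}) = w})
    \<le> (\<Sum>w\<in>W. card W * enn2real (a w) + ?I w)"
    unfolding sum_distrib_left by (intro sum_mono bound)
  also have "\<dots> = card W * (\<Sum>w\<in>W. enn2real (a w)) + (\<Sum>w\<in>W. ?I w)"
    by (simp add: sum.distrib sum_distrib_left)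
  also have "\<dots> \<le> card W * 1 + (\<Sum>w\<in>W. ?I w)"
    using mult_left_mono[OF a_real, of "card W"] by simp
  finally show ?thesis by simp
qed

text \<open>A, B, C stand for the averages of X_1^2, X_2^2 and X_1 X_2.\<close>

lemma correlation_split:
  fixes A B C P1 P2 :: real
  assumes "P1 > 0" "P2 > 0" and A: "0 \<le> A" "A \<le> P1" and B: "B \<le> P2"
    and form: "\<And>t. t\<^sup>2 * A + 2 * t * C + B \<ge> 0"
  shows "\<exists>\<rho>\<in>{0..1}. \<exists>\<beta>. \<beta>\<^sup>2 * A - 2 * \<beta> * C + B \<le> P2 * (1 - \<rho>\<^sup>2) \<and>
    A + B + 2 * C \<le> P1 + P2 + 2 * sqrt (P1 * P2) * \<rho>"
proof (cases "A = 0")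
  case True
  have "C = 0"
  proof (rule ccontr)
    assume "C \<noteq> 0"
    \<comment> \<open>With \<open>A = 0\<close> the form is linear in \<open>t\<close>, and this
      \<open>t\<close> gives it the value -1.\<close>
    then show False
      using form[of "- (B + 1) / (2 * C)"] True by (simp add: field_simps)
  qed
  then show ?thesis
    using True A(2) B by (intro bexI[of _ 0] exI[of _ 0]) simp_all
next
  case False
  with A have A0: "A > 0" by simp
  \<comment> \<open>\<open>V\<close> is the mean square error of the best linear estimate of X_2
    from X_1, whose coefficient is \<open>C / A\<close>; \<open>\<rho>\<close> is chosen so that
    \<open>P2 * (1 - \<rho>\<^sup>2)\<close> equals \<open>V\<close>.\<close>
  define V where "V = B - C\<^sup>2 / A"
  define \<rho> where "\<rho> = sqrt (1 - V / P2)"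
  have V0: "V \<ge> 0"
    using form[of "- C / A"] A0 by (simp add: V_def power2_eq_square field_simps)
  have "C\<^sup>2 / A \<ge> 0" using A0 by simp
  then have VB: "V \<le> P2" using B unfolding V_def by linarith
  have \<rho>2: "\<rho>\<^sup>2 = 1 - V / P2" using VB assms(2) by (simp add: \<rho>_def)
  have \<rho>: "\<rho> \<in> {0..1}" using V0 VB assms(2) by (simp add: \<rho>_def)
  have "C\<^sup>2 = A * (B - V)" using A0 by (simp add: V_def)
  \<comment> \<open>The powers are raised to their limits while \<open>V\<close> stays fixed; this
    bounds \<open>C\<close> by \<open>sqrt (P1 * P2) * \<rho>\<close>.\<close>
  also have "\<dots> \<le> P1 * (P2 - V)"
    using A B \<open>C\<^sup>2 / A \<ge> 0\<close> assms(1) by (intro mult_mono) (simp_all add: V_def)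
  also have "\<dots> = P1 * P2 * \<rho>\<^sup>2" unfolding \<rho>2 using assms(2) by (simp add: field_simps)
  finally have "\<bar>C\<bar> \<le> sqrt (P1 * P2 * \<rho>\<^sup>2)" by (simp add: real_le_rsqrt)
  then have "C \<le> sqrt (P1 * P2) * \<rho>" using \<rho> by (simp add: real_sqrt_mult)
  moreover have "(C / A)\<^sup>2 * A - 2 * (C / A) * C + B = V"
    using A0 by (simp add: V_def power2_eq_square field_simps)
  moreover have "P2 * (1 - \<rho>\<^sup>2) = V" unfolding \<rho>2 using assms(2) by simp
  ultimately show ?thesis
    using A(2) B by (intro bexI[OF _ \<rho>] exI[of _ "C / A"] conjI) linarith+
qed

section \<open>Codes as triangular channels\<close>

definition chan_seq where
  "chan_seq f1 f2 w1 w2 z i = X1 f1 f2 w1 w2 z i + X2 f1 f2 w1 w2 z i + z i"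

lemma chan_out_eq_map: "chan_out f1 f2 w1 w2 z n = map (chan_seq f1 f2 w1 w2 z) [0..<n]"
  by (induction n) (auto simp: Let_def chan_seq_def X1_def X2_def)

lemma map_upt_restrict: "n \<le> m \<Longrightarrow> map (restrict y {..<m}) [0..<n] = map y [0..<n]"
  by (intro map_cong) auto

text \<open>Subtracting from each desired output the inputs that the earlier desired outputs call
  for gives the noise that produces them.\<close>

lemma chan_out_inverse:
  assumes "\<And>j. j < n \<Longrightarrow> z j = y j - (f1 j w1 (map y [0..<j]) + f2 j w1 w2 (map y [0..<j]))"
  shows "chan_out f1 f2 w1 w2 z n = map y [0..<n]"
  using assms by (induction n) (auto simp: Let_def)

text \<open>A code is only known to be measurable as a function of the noise; inverting the
  channel recursively makes it measurable as a function of the output.\<close>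

lemma noise_of_output_measurable:
  assumes X: "\<And>i. i < N \<Longrightarrow> (\<lambda>z. X1 f1 f2 w1 w2 z i) \<in> borel_measurable (noise_space s N)"
    "\<And>i. i < N \<Longrightarrow> (\<lambda>z. X2 f1 f2 w1 w2 z i) \<in> borel_measurable (noise_space s N)"
    and "n \<le> N" "{..<n} \<subseteq> I"
  shows "(\<lambda>y. \<lambda>j\<in>{..<N}. if j < n then y j - (f1 j w1 (map y [0..<j]) + f2 j w1 w2 (map y [0..<j])) else 0)
    \<in> measurable (PiM I (\<lambda>_. borel)) (noise_space s N)"
  using assms(3,4)
proof (induction n)
  case 0
  show ?case unfolding measurable_cong_sets[OF refl sets_noise]
    by (intro measurable_restrict) auto
next
  case (Suc n)
  let ?x = "\<lambda>j y. f1 j w1 (map y [0..<j]) + f2 j w1 w2 (map y [0..<j])"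
  define T where "T = (\<lambda>y. \<lambda>j\<in>{..<N}. if j < n then y j - ?x j y else (0::real))"
  have T[measurable]: "T \<in> measurable (PiM I (\<lambda>_. borel)) (noise_space s N)"
    unfolding T_def by (rule Suc.IH) (use Suc.prems in auto)
  \<comment> \<open>The noise values recovered from \<open>y\<close> reproduce its first
    \<open>n\<close> entries as outputs, so the input at time \<open>n\<close>, as a function of
    \<open>y\<close>, is the code's own input at noise \<open>T y\<close>. The zeros filling the
    later coordinates are harmless: the first \<open>n\<close> outputs do not read them.\<close>
  have "chan_out f1 f2 w1 w2 (T y) n = map y [0..<n]" for y
    using Suc.prems by (intro chan_out_inverse) (simp add: T_def)
  then have eq: "X1 f1 f2 w1 w2 (T y) n + X2 f1 f2 w1 w2 (T y) n = ?x n y" for y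
    by (simp add: X1_def X2_def)
  have "n < N" using Suc.prems by simp
  note [measurable] = X[OF this]
  have "(\<lambda>y. X1 f1 f2 w1 w2 (T y) n + X2 f1 f2 w1 w2 (T y) n) \<in> borel_measurable (PiM I (\<lambda>_. borel))"
    by measurable
  then have [measurable]: "?x n \<in> borel_measurable (PiM I (\<lambda>_. borel))"
    by (simp add: eq)
  have [measurable]: "(\<lambda>y. y n) \<in> borel_measurable (PiM I (\<lambda>_. borel))"
    using Suc.prems by (intro measurable_component_singleton) auto
  have "(\<lambda>y. if j < Suc n then y j - ?x j y else 0) \<in> borel_measurable (PiM I (\<lambda>_. borel))" if j: "j < N" for j
  proof (cases "j < n")
    case True
    have [measurable]: "(\<lambda>z. z j) \<in> borel_measurable (noise_space s N)"
      unfolding measurable_cong_sets[OF sets_noise refl]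
      using j by (intro measurable_component_singleton) simp
    have "(\<lambda>y. T y j) \<in> borel_measurable (PiM I (\<lambda>_. borel))" by measurable
    with True j show ?thesis by (simp add: T_def)
  next
    case False
    then consider "j = n" | "j > n" by linarith
    then show ?thesis by cases simp_all
  qed
  then show ?case
    unfolding measurable_cong_sets[OF refl sets_noise] by (intro measurable_restrict) auto
qed

text \<open>Composition with the recovered noise carries measurability from the noise to the
  outputs. It serves both encoders and the decoder.\<close>

lemma output_measurable:
  assumes X: "\<And>i. i < N \<Longrightarrow> (\<lambda>z. X1 f1 f2 w1 w2 z i) \<in> borel_measurable (noise_space s N)"
    "\<And>i. i < N \<Longrightarrow> (\<lambda>z. X2 f1 f2 w1 w2 z i) \<in> borel_measurable (noise_space s N)"
    and n: "n \<le> N" "{..<n} \<subseteq> I"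
    and g: "(\<lambda>z. g (chan_out f1 f2 w1 w2 z n)) \<in> measurable (noise_space s N) K"
  shows "(\<lambda>y. g (map y [0..<n])) \<in> measurable (PiM I (\<lambda>_. borel)) K"
proof -
  have "chan_out f1 f2 w1 w2 (\<lambda>j\<in>{..<N}. if j < n then y j - (f1 j w1 (map y [0..<j]) + f2 j w1 w2 (map y [0..<j])) else 0) n
    = map y [0..<n]" for y
    using n by (intro chan_out_inverse) simp
  then show ?thesis
    using measurable_compose[OF noise_of_output_measurable[OF X n] g] by simp
qed

text \<open>Used to pass from a power constraint in extended nonnegative integrals to integrability
  of each single term and a bound on real integrals.\<close>

lemma sum_nn_integral_bound:
  fixes g :: "'k \<Rightarrow> 'a \<Rightarrow> real"
  assumes K: "finite K" and g: "\<And>k. k \<in> K \<Longrightarrow> g k \<in> borel_measurable M" "\<And>k z. 0 \<le> g k z"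
    and c: "0 \<le> c" and le: "(\<Sum>k\<in>K. \<integral>\<^sup>+z. ennreal (g k z) \<partial>M) \<le> ennreal c"
  shows "k \<in> K \<Longrightarrow> integrable M (g k)" and "(\<Sum>k\<in>K. \<integral>z. g k z \<partial>M) \<le> c"
proof -
  have int: "integrable M (g k)" if k: "k \<in> K" for k
  proof -
    have "(\<integral>\<^sup>+z. ennreal (g k z) \<partial>M) \<le> ennreal c"
      by (rule order_trans[OF member_le_sum le]) (use k K in auto)
    then have "(\<integral>\<^sup>+z. ennreal (g k z) \<partial>M) < \<infinity>"
      by (simp add: order_le_less_trans)
    then show ?thesis using g k by (intro integrableI_nonneg) auto
  qed
  then show "k \<in> K \<Longrightarrow> integrable M (g k)" .
  have "ennreal (\<Sum>k\<in>K. \<integral>z. g k z \<partial>M) = (\<Sum>k\<in>K. ennreal (\<integral>z. g k z \<partial>M))"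
    using g by (intro sum_ennreal[symmetric]) simp
  also have "\<dots> = (\<Sum>k\<in>K. \<integral>\<^sup>+z. ennreal (g k z) \<partial>M)"
    using int g by (intro sum.cong) (auto simp: nn_integral_eq_integral)
  also note le
  finally show "(\<Sum>k\<in>K. \<integral>z. g k z \<partial>M) \<le> c" using c by simp
qed

section \<open>Converse for one code and passage to the limit\<close>

text \<open>Both bounds must hold with the same \<open>\<rho>\<close>, which comes from second
  moments of the inputs averaged over time and all messages at once. A single reference variance for
  all letters takes the place of Jensen's inequality. The additive 1 is the Fano term.\<close>

lemma code_converse:
  assumes P: "P1 > 0" "P2 > 0" and s: "s > 0" and N: "N > 0"
    and code: "fb_code P1 P2 s N M1 M2 f1 f2 psi"
  shows "\<exists>\<rho>\<in>{0..1}.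
    (1 - err_prob s N M1 M2 f1 f2 psi) * ln M2 \<le> N / 2 * ln (1 + P2 * (1 - \<rho>\<^sup>2) / s) + 1 \<and>
    (1 - err_prob s N M1 M2 f1 f2 psi) * ln (real M1 * real M2)
      \<le> N / 2 * ln (1 + (P1 + P2 + 2 * sqrt (P1 * P2) * \<rho>) / s) + 1"
proof -
  let ?M = "noise_space s N"
  interpret prob_space ?M by (rule prob_space_noise[OF s])
  define W where "W = {1..M1} \<times> {1..M2}"
  define x where "x = (\<lambda>w i y. f1 i (fst w) (map y [0..<i]) + f2 i (fst w) (snd w) (map y [0..<i]))"
  define Y where "Y = (\<lambda>w. chan_seq f1 f2 (fst w) (snd w))"
  define F where "F = (\<lambda>w i z. X1 f1 f2 (fst w) (snd w) z i)"
  define G where "G = (\<lambda>w i z. X2 f1 f2 (fst w) (snd w) z i)"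
  define dec where "dec = (\<lambda>y. psi (map y [0..<N]))"
  define Pc where "Pc = (\<lambda>w. measure ?M {z \<in> space ?M. dec (restrict (Y w z) {..<N}) = w})"
  \<comment> \<open>The energy of X_2 + b X_1 over the whole block for the message pair
    \<open>w\<close>; its average over time and messages is the quadratic form that
    \<open>correlation_split\<close> takes.\<close>
  define S where "S = (\<lambda>w b. \<Sum>i<N. \<integral>z. (G w i z + b * F w i z)\<^sup>2 \<partial>?M)"
  have M: "M1 \<ge> 1" "M2 \<ge> 1" using code by (auto simp: fb_code_def)
  have W: "finite W" "W \<noteq> {}" "card W = M1 * M2" using M by (auto simp: W_def)
  have F[measurable]: "F w i \<in> borel_measurable ?M"
    and G[measurable]: "G w i \<in> borel_measurable ?M" if "w \<in> W" "i < N" for w i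
    using code that by (auto simp: fb_code_def W_def F_def G_def)
  have psi: "(\<lambda>z. psi (chan_out f1 f2 (fst w) (snd w) z N)) \<in> measurable ?M (count_space UNIV)" if "w \<in> W" for w
    using code that by (auto simp: fb_code_def W_def)
  have F_eq: "F w i z = f1 i (fst w) (map (Y w z) [0..<i])"
    and G_eq: "G w i z = f2 i (fst w) (snd w) (map (Y w z) [0..<i])" for w i z
    by (simp_all add: F_def G_def X1_def X2_def chan_out_eq_map Y_def)
  have f1: "(\<lambda>y. f1 i (fst w) (map y [0..<i])) \<in> borel_measurable (PiM {..<i} (\<lambda>_. borel))"
    if "w \<in> W" "i < N" for w i
    by (rule output_measurable[of N f1 f2 "fst w" "snd w" s])
       (use that F G in \<open>auto simp: F_def G_def X1_def\<close>)
  have f2: "(\<lambda>y. f2 i (fst w) (snd w) (map y [0..<i])) \<in> borel_measurable (PiM {..<i} (\<lambda>_. borel))"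
    if "w \<in> W" "i < N" for w i
    by (rule output_measurable[of N f1 f2 "fst w" "snd w" s])
       (use that F G in \<open>auto simp: F_def G_def X2_def\<close>)
  obtain w0 where w0: "w0 \<in> W" using W by auto
  have dec: "dec \<in> measurable (PiM {..<N} (\<lambda>_. borel)) (count_space UNIV)"
    unfolding dec_def
    by (rule output_measurable[of N f1 f2 "fst w0" "snd w0" s])
       (use w0 F G psi in \<open>auto simp: F_def G_def\<close>)
  have chan: "triangular_channel N (x w) (Y w)" if w: "w \<in> W" for w
  proof
    show "Y w z i = z i + x w i (restrict (Y w z) {..<i})" for z i
      using F_eq[of w i z] G_eq[of w i z]
      by (simp add: Y_def chan_seq_def F_def G_def x_def map_upt_restrict)
    show "x w i \<in> borel_measurable (PiM {..<i} (\<lambda>_. borel))" if "i < N" for i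
      unfolding x_def using f1[OF w that] f2[OF w that] by simp
  qed
  have sumW: "(\<Sum>i<N. \<Sum>w1\<in>{1..M1}. \<Sum>w2\<in>{1..M2}. h i (w1, w2)) = (\<Sum>(i, w)\<in>{..<N} \<times> W. h i w)" for h :: "nat \<Rightarrow> nat \<times> nat \<Rightarrow> ennreal"
    unfolding W_def by (simp add: sum.cartesian_product')
  have powF: "(\<Sum>k\<in>{..<N} \<times> W. \<integral>\<^sup>+z. ennreal ((F (snd k) (fst k) z)\<^sup>2) \<partial>?M) \<le> ennreal (N * M1 * M2 * P1)"
    and powG: "(\<Sum>k\<in>{..<N} \<times> W. \<integral>\<^sup>+z. ennreal ((G (snd k) (fst k) z)\<^sup>2) \<partial>?M) \<le> ennreal (N * M1 * M2 * P2)"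
    using code sumW[of "\<lambda>i w. \<integral>\<^sup>+z. ennreal ((F w i z)\<^sup>2) \<partial>?M"] sumW[of "\<lambda>i w. \<integral>\<^sup>+z. ennreal ((G w i z)\<^sup>2) \<partial>?M"]
    by (simp_all add: fb_code_def F_def G_def case_prod_unfold)
  have intF: "integrable ?M (\<lambda>z. (F w i z)\<^sup>2)" if "w \<in> W" "i < N" for w i
    using sum_nn_integral_bound(1)[OF _ _ _ _ powF, of "(i, w)"] that W P by auto
  have intG: "integrable ?M (\<lambda>z. (G w i z)\<^sup>2)" if "w \<in> W" "i < N" for w i
    using sum_nn_integral_bound(1)[OF _ _ _ _ powG, of "(i, w)"] that W P by auto
  have intFG: "integrable ?M (\<lambda>z. F w i z * G w i z)" if "w \<in> W" "i < N" for w i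
    using that by (intro integrable_mult_of_squares F G intF intG)
  \<comment> \<open>\<open>T\<close> counts time instants and message pairs together, so
    \<open>a\<close>, \<open>b\<close> and \<open>c\<close> are averages over both.\<close>
  define T where "T = real (N * M1 * M2)"
  define a where "a = (\<Sum>w\<in>W. \<Sum>i<N. \<integral>z. (F w i z)\<^sup>2 \<partial>?M) / T"
  define b where "b = (\<Sum>w\<in>W. \<Sum>i<N. \<integral>z. (G w i z)\<^sup>2 \<partial>?M) / T"
  define c where "c = (\<Sum>w\<in>W. \<Sum>i<N. \<integral>z. F w i z * G w i z \<partial>?M) / T"
  have T: "T > 0" using N M by (simp add: T_def)
  have swap: "(\<Sum>w\<in>W. \<Sum>i<N. h i w) = (\<Sum>k\<in>{..<N} \<times> W. h (fst k) (snd k))" for h :: "nat \<Rightarrow> nat \<times> nat \<Rightarrow> real"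
    by (subst sum.swap) (simp add: sum.cartesian_product case_prod_unfold)
  have "a \<le> P1"
  proof -
    have "(\<Sum>k\<in>{..<N} \<times> W. \<integral>z. (F (snd k) (fst k) z)\<^sup>2 \<partial>?M) \<le> T * P1"
      using sum_nn_integral_bound(2)[OF _ _ _ _ powF] W P by (auto simp: T_def)
    then show ?thesis using T unfolding a_def swap by (simp add: field_simps)
  qed
  have "b \<le> P2"
  proof -
    have "(\<Sum>k\<in>{..<N} \<times> W. \<integral>z. (G (snd k) (fst k) z)\<^sup>2 \<partial>?M) \<le> T * P2"
      using sum_nn_integral_bound(2)[OF _ _ _ _ powG] W P by (auto simp: T_def)
    then show ?thesis using T unfolding b_def swap by (simp add: field_simps)
  qed
  have "a \<ge> 0" using T by (simp add: a_def sum_nonneg)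
  have S: "(\<Sum>w\<in>W. S w t) = T * (t\<^sup>2 * a + 2 * t * c + b)" for t
  proof -
    have "(\<integral>z. (G w i z + t * F w i z)\<^sup>2 \<partial>?M)
      = t\<^sup>2 * (\<integral>z. (F w i z)\<^sup>2 \<partial>?M) + 2 * t * (\<integral>z. F w i z * G w i z \<partial>?M) + (\<integral>z. (G w i z)\<^sup>2 \<partial>?M)"
      if "w \<in> W" "i < N" for w i
    proof -
      have eq: "(G w i z + t * F w i z)\<^sup>2 = t\<^sup>2 * (F w i z)\<^sup>2 + 2 * t * (F w i z * G w i z) + (G w i z)\<^sup>2" for z
        by (simp add: power2_eq_square algebra_simps)
      show ?thesis unfolding eq using intF[OF that] intG[OF that] intFG[OF that] by simp
    qed
    then have "(\<Sum>w\<in>W. S w t) = (\<Sum>w\<in>W. \<Sum>i<N. t\<^sup>2 * (\<integral>z. (F w i z)\<^sup>2 \<partial>?M) + 2 * t * (\<integral>z. F w i z * G w i z \<partial>?M) + (\<integral>z. (G w i z)\<^sup>2 \<partial>?M))"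
      unfolding S_def by (intro sum.cong) auto
    also have "\<dots> = t\<^sup>2 * (T * a) + 2 * t * (T * c) + T * b"
    proof -
      have "T * a = (\<Sum>w\<in>W. \<Sum>i<N. \<integral>z. (F w i z)\<^sup>2 \<partial>?M)"
        "T * b = (\<Sum>w\<in>W. \<Sum>i<N. \<integral>z. (G w i z)\<^sup>2 \<partial>?M)"
        "T * c = (\<Sum>w\<in>W. \<Sum>i<N. \<integral>z. F w i z * G w i z \<partial>?M)"
        using T by (simp_all add: a_def b_def c_def)
      then show ?thesis by (simp only: sum.distrib sum_distrib_left[symmetric])
    qed
    finally show ?thesis by (simp add: algebra_simps)
  qed
  have form: "t\<^sup>2 * a + 2 * t * c + b \<ge> 0" for t
  proof -
    have "(\<Sum>w\<in>W. S w t) \<ge> 0" unfolding S_def by (intro sum_nonneg) simp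
    then show ?thesis using T S by (simp add: zero_le_mult_iff)
  qed
  obtain \<rho> \<beta> where \<rho>: "\<rho> \<in> {0..1}"
    and r2: "\<beta>\<^sup>2 * a - 2 * \<beta> * c + b \<le> P2 * (1 - \<rho>\<^sup>2)"
    and r12: "a + b + 2 * c \<le> P1 + P2 + 2 * sqrt (P1 * P2) * \<rho>"
    using correlation_split[OF P \<open>a \<ge> 0\<close> \<open>a \<le> P1\<close> \<open>b \<le> P2\<close> form] by blast
  \<comment> \<open>The reference mean \<gamma> X_1 has to be the same function of the outputs for
    every pair in \<open>V\<close>. With \<open>\<gamma>\<close> nonzero, \<open>V\<close> therefore
    shares its first message, which amounts to revealing that message to the receiver.\<close>
  have fano: "ln (card V) * (\<Sum>w\<in>V. Pc w)
      \<le> card V * (1 + N * (ln (\<tau> / s) / 2 + s / (2 * \<tau>) - 1 / 2)) + (\<Sum>w\<in>V. S w (1 - \<gamma>)) / (2 * \<tau>)"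
    if V: "V \<subseteq> W" "V \<noteq> {}" and v: "v \<in> W" and \<tau>: "\<tau> > 0"
      and \<gamma>: "\<gamma> = 0 \<or> (\<forall>w\<in>V. fst w = fst v)" for V v \<tau> \<gamma>
  proof -
    define \<mu> where "\<mu> = (\<lambda>i y. \<gamma> * f1 i (fst v) (map y [0..<i]))"
    have \<Delta>: "x w i (restrict (Y w z) {..<i}) - \<mu> i (restrict (Y w z) {..<i}) = G w i z + (1 - \<gamma>) * F w i z"
      if "w \<in> V" for w i z
      using \<gamma> that by (auto simp: x_def \<mu>_def map_upt_restrict F_eq G_eq algebra_simps)
    have fin: "finite V" using V W finite_subset by blast
    have "ln (card V) * (\<Sum>w\<in>V. Pc w) \<le> card V + (\<Sum>w\<in>V. \<Sum>i<N. ln (\<tau> / s) / 2 +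
        ((\<integral>z. (x w i (restrict (Y w z) {..<i}) - \<mu> i (restrict (Y w z) {..<i}))\<^sup>2 \<partial>?M) + s) / (2 * \<tau>) - 1 / 2)"
      unfolding Pc_def
    proof (rule fano_inequality[OF s \<tau> fin V(2) _ _ dec])
      fix w assume w: "w \<in> V"
      then show "triangular_channel N (x w) (Y w)" using V by (intro chan) auto
      fix i assume i: "i < N"
      have "w \<in> W" using w V by auto
      note intF[OF this i] intG[OF this i] intFG[OF this i]
      moreover have "(G w i z + (1 - \<gamma>) * F w i z)\<^sup>2 = (1 - \<gamma>)\<^sup>2 * (F w i z)\<^sup>2 + 2 * (1 - \<gamma>) * (F w i z * G w i z) + (G w i z)\<^sup>2" for z
        by (simp add: power2_eq_square algebra_simps)
      ultimately show "integrable ?M (\<lambda>z. (x w i (restrict (Y w z) {..<i}) - \<mu> i (restrict (Y w z) {..<i}))\<^sup>2)"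
        unfolding \<Delta>[OF w] by simp
    next
      fix i assume "i < N"
      then show "\<mu> i \<in> borel_measurable (PiM {..<i} (\<lambda>_. borel))"
        unfolding \<mu>_def using f1[OF v] by simp
    qed
    also have "(\<Sum>w\<in>V. \<Sum>i<N. ln (\<tau> / s) / 2 +
        ((\<integral>z. (x w i (restrict (Y w z) {..<i}) - \<mu> i (restrict (Y w z) {..<i}))\<^sup>2 \<partial>?M) + s) / (2 * \<tau>) - 1 / 2)
      = (\<Sum>w\<in>V. \<Sum>i<N. (ln (\<tau> / s) / 2 + s / (2 * \<tau>) - 1 / 2) + (\<integral>z. (G w i z + (1 - \<gamma>) * F w i z)\<^sup>2 \<partial>?M) / (2 * \<tau>))"
      by (intro sum.cong) (auto simp: \<Delta> add_divide_distrib)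
    also have "\<dots> = card V * (N * (ln (\<tau> / s) / 2 + s / (2 * \<tau>) - 1 / 2)) + (\<Sum>w\<in>V. S w (1 - \<gamma>)) / (2 * \<tau>)"
      unfolding S_def by (simp only: sum.distrib sum_divide_distrib) simp
    finally show ?thesis by (simp add: algebra_simps)
  qed
  have Pc: "(\<Sum>w\<in>W. Pc w) = M1 * M2 * (1 - err_prob s N M1 M2 f1 f2 psi)"
  proof -
    have "measure ?M {z \<in> space ?M. psi (chan_out f1 f2 (fst w) (snd w) z N) \<noteq> w} = 1 - Pc w" if w: "w \<in> W" for w
    proof -
      note [measurable] = psi[OF w]
      have "dec (restrict (Y w z) {..<N}) = psi (chan_out f1 f2 (fst w) (snd w) z N)" for z
        by (simp add: dec_def map_upt_restrict chan_out_eq_map Y_def)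
      then show ?thesis
        unfolding Pc_def by (simp only:) (rule prob_neg, measurable)
    qed
    then have "err_prob s N M1 M2 f1 f2 psi = (\<Sum>w\<in>W. 1 - Pc w) / (M1 * M2)"
      unfolding err_prob_def sum.cartesian_product W_def[symmetric]
      by (simp add: case_prod_unfold)
    then show ?thesis using M W by (simp add: sum_subtractf field_simps)
  qed
  \<comment> \<open>The variance is \<open>\<tau> = s + q\<close>, where \<open>q\<close> bounds the
    average energy left after subtracting the reference mean. Then
    \<open>s / (2 * \<tau>) + q / (2 * \<tau>) - 1 / 2\<close> vanishes and half the logarithm of
    \<open>1 + q / s\<close> remains.\<close>
  have finish: "(1 - err_prob s N M1 M2 f1 f2 psi) * l \<le> N / 2 * ln (1 + q / s) + 1"
    if le: "l * (\<Sum>w\<in>W. Pc w) \<le> M1 * M2 * (1 + N * (ln ((s + q) / s) / 2 + s / (2 * (s + q)) - 1 / 2)) + (\<Sum>w\<in>W. S w t) / (2 * (s + q))"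
      and q: "q \<ge> 0" and t: "t\<^sup>2 * a + 2 * t * c + b \<le> q" for l q t
  proof -
    have "(\<Sum>w\<in>W. S w t) / (2 * (s + q)) \<le> T * q / (2 * (s + q))"
      unfolding S using T t q s by (intro divide_right_mono mult_left_mono) auto
    also have "\<dots> = M1 * M2 * (N * (q / (2 * (s + q))))" by (simp add: T_def)
    finally have "l * (\<Sum>w\<in>W. Pc w) \<le> M1 * M2 * (1 + N * (ln ((s + q) / s) / 2 + s / (2 * (s + q)) - 1 / 2 + q / (2 * (s + q))))"
      using le by (simp add: algebra_simps)
    moreover have "s / (2 * (s + q)) - 1 / 2 + q / (2 * (s + q)) = 0"
      using s q by (simp add: field_simps)
    then have "ln ((s + q) / s) / 2 + s / (2 * (s + q)) - 1 / 2 + q / (2 * (s + q)) = ln ((s + q) / s) / 2"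
      by linarith
    ultimately have "l * (\<Sum>w\<in>W. Pc w) \<le> M1 * M2 * (1 + N * (ln ((s + q) / s) / 2))"
      by (simp only:)
    then have "M1 * M2 * ((1 - err_prob s N M1 M2 f1 f2 psi) * l) \<le> M1 * M2 * (1 + N * (ln ((s + q) / s) / 2))"
      unfolding Pc by (simp add: mult_ac)
    then have "(1 - err_prob s N M1 M2 f1 f2 psi) * l \<le> 1 + N * (ln ((s + q) / s) / 2)"
      using M by (subst (asm) mult_le_cancel_left_pos) auto
    moreover have "(s + q) / s = 1 + q / s" using s by (simp add: field_simps)
    ultimately show ?thesis by simp
  qed
  have \<rho>2: "\<rho>\<^sup>2 \<le> 1" using \<rho> by (simp add: power_le_one)
  have sum_rate: "(1 - err_prob s N M1 M2 f1 f2 psi) * ln (real M1 * real M2)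
      \<le> N / 2 * ln (1 + (P1 + P2 + 2 * sqrt (P1 * P2) * \<rho>) / s) + 1"
  proof -
    have q: "0 \<le> P1 + P2 + 2 * sqrt (P1 * P2) * \<rho>" using P \<rho> by simp
    have t: "1\<^sup>2 * a + 2 * 1 * c + b \<le> P1 + P2 + 2 * sqrt (P1 * P2) * \<rho>" using r12 by simp
    let ?\<tau> = "s + (P1 + P2 + 2 * sqrt (P1 * P2) * \<rho>)"
    have "?\<tau> > 0" using q s by linarith
    \<comment> \<open>With \<open>\<gamma> = 0\<close> the reference output is centered and all
      pairs are to be decoded.\<close>
    from fano[OF order_refl W(2) w0 this, of 0]
    have "ln (real M1 * real M2) * (\<Sum>w\<in>W. Pc w) \<le> M1 * M2 * (1 + N * (ln (?\<tau> / s) / 2 + s / (2 * ?\<tau>) - 1 / 2)) + (\<Sum>w\<in>W. S w 1) / (2 * ?\<tau>)"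
      by (simp add: W)
    from finish[OF this q t] show ?thesis .
  qed
  have "(1 - err_prob s N M1 M2 f1 f2 psi) * ln M2 \<le> N / 2 * ln (1 + P2 * (1 - \<rho>\<^sup>2) / s) + 1"
  proof -
    have q: "0 \<le> P2 * (1 - \<rho>\<^sup>2)" using P \<rho>2 by simp
    have t: "(-\<beta>)\<^sup>2 * a + 2 * (-\<beta>) * c + b \<le> P2 * (1 - \<rho>\<^sup>2)" using r2 by simp
    let ?\<tau> = "s + P2 * (1 - \<rho>\<^sup>2)"
    let ?r = "1 + N * (ln (?\<tau> / s) / 2 + s / (2 * ?\<tau>) - 1 / 2)"
    have \<tau>: "?\<tau> > 0" using q s by linarith
    have split: "(\<Sum>w\<in>W. h w) = (\<Sum>w1\<in>{1..M1}. \<Sum>w\<in>{w1} \<times> {1..M2}. h w)" for h :: "nat \<times> nat \<Rightarrow> real"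
      unfolding W_def by (simp add: sum.cartesian_product')
    \<comment> \<open>One first message at a time, with \<open>\<gamma> = 1 + \<beta>\<close>:
      subtracting (1 + \<beta>) X_1 from X_1 + X_2 leaves X_2 - \<beta> X_1. Summing over
      \<open>w1\<close> restores the average over all pairs.\<close>
    have "ln M2 * (\<Sum>w\<in>{w1} \<times> {1..M2}. Pc w) \<le> M2 * ?r + (\<Sum>w\<in>{w1} \<times> {1..M2}. S w (-\<beta>)) / (2 * ?\<tau>)"
      if "w1 \<in> {1..M1}" for w1
    proof -
      have "{w1} \<times> {1..M2} \<subseteq> W" "{w1} \<times> {1..M2} \<noteq> {}" "(w1, 1) \<in> W"
        using that M by (auto simp: W_def)
      from fano[OF this \<tau>, of "1 + \<beta>"] show ?thesis by (simp add: card_cartesian_product)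
    qed
    then have "(\<Sum>w1\<in>{1..M1}. ln M2 * (\<Sum>w\<in>{w1} \<times> {1..M2}. Pc w))
      \<le> (\<Sum>w1\<in>{1..M1}. M2 * ?r + (\<Sum>w\<in>{w1} \<times> {1..M2}. S w (-\<beta>)) / (2 * ?\<tau>))"
      by (intro sum_mono)
    also have "\<dots> = (\<Sum>w1\<in>{1..M1}. M2 * ?r) + (\<Sum>w1\<in>{1..M1}. \<Sum>w\<in>{w1} \<times> {1..M2}. S w (-\<beta>)) / (2 * ?\<tau>)"
      unfolding sum_divide_distrib by (rule sum.distrib)
    also have "(\<Sum>w1\<in>{1..M1}. M2 * ?r) = M1 * M2 * ?r"
      by simp
    finally have "ln M2 * (\<Sum>w\<in>W. Pc w) \<le> M1 * M2 * ?r + (\<Sum>w\<in>W. S w (-\<beta>)) / (2 * ?\<tau>)"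
      unfolding split sum_distrib_left .
    from finish[OF this q t] show ?thesis .
  qed
  then show ?thesis by (intro bexI[OF _ \<rho>] conjI sum_rate)
qed

text \<open>The correlation supplied by \<open>code_converse\<close> varies with the tolerance. A
  subsequence of correlations converges, and continuity of both rate bounds passes the inequalities
  to its limit.\<close>

lemma achievable_imp_region:
  assumes P: "P1 > 0" "P2 > 0" and s: "s > 0" and ach: "achievable_fb P1 P2 s (R1, R2)"
  shows "\<exists>\<rho>\<in>{0..1}. R2 \<le> 1/2 * log 2 (1 + P2 * (1 - \<rho>\<^sup>2) / s) \<and>
    R1 + R2 \<le> 1/2 * log 2 (1 + (P1 + P2 + 2 * sqrt (P1 * P2) * \<rho>) / s)"
proof -
  define c2 where "c2 = (\<lambda>\<rho>. 1/2 * log 2 (1 + P2 * (1 - \<rho>\<^sup>2) / s))"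
  define c12 where "c12 = (\<lambda>\<rho>. 1/2 * log 2 (1 + (P1 + P2 + 2 * sqrt (P1 * P2) * \<rho>) / s))"
  have approx: "\<exists>\<rho>\<in>{0..1}. (1 - e) * (R2 - e) \<le> c2 \<rho> + e / ln 2 \<and> (1 - e) * (R1 + R2 - 2 * e) \<le> c12 \<rho> + e / ln 2"
    if e: "0 < e" "e < 1" for e
  proof -
    obtain N0 where N0: "\<And>N. N \<ge> N0 \<Longrightarrow> N > 0 \<Longrightarrow> \<exists>M1 M2 f1 f2 psi.
        fb_code P1 P2 s N M1 M2 f1 f2 psi \<and> log 2 (real M1) / real N \<ge> R1 - e \<and>
        log 2 (real M2) / real N \<ge> R2 - e \<and> err_prob s N M1 M2 f1 f2 psi \<le> e"
      using ach e unfolding achievable_fb_def by (metis fst_conv snd_conv)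
    \<comment> \<open>Long enough for the additive Fano term, divided by \<open>N\<close>, to be at
      most \<open>e\<close>.\<close>
    define N where "N = max N0 (nat \<lceil>1 / e\<rceil> + 1)"
    have N: "N > 0" "N \<ge> N0" by (auto simp: N_def)
    have "1 / e \<le> N" unfolding N_def by linarith
    then have Ne: "1 / N \<le> e" using e N by (simp add: field_simps)
    obtain M1 M2 f1 f2 psi where code: "fb_code P1 P2 s N M1 M2 f1 f2 psi"
      and l1: "log 2 (real M1) / real N \<ge> R1 - e" and l2: "log 2 (real M2) / real N \<ge> R2 - e"
      and err: "err_prob s N M1 M2 f1 f2 psi \<le> e"
      using N0[OF N(2,1)] by blast
    have M: "real M1 \<ge> 1" "real M2 \<ge> 1" using code by (auto simp: fb_code_def)
    have scale: "(1 - e) * r \<le> 1/2 * log 2 q + e / ln 2"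
      if r: "N * ln 2 * r \<le> l" and l: "l \<ge> 0" and b: "(1 - err_prob s N M1 M2 f1 f2 psi) * l \<le> N / 2 * ln q + 1" for r l q
    proof -
      have "(1 - e) * (N * ln 2 * r) \<le> (1 - e) * l" using r e by (intro mult_left_mono) auto
      also have "\<dots> \<le> (1 - err_prob s N M1 M2 f1 f2 psi) * l" using err l by (intro mult_right_mono) auto
      also note b
      also have "N / 2 * ln q + 1 \<le> N / 2 * ln q + N * e" using Ne N by (simp add: field_simps)
      also have "\<dots> = N * ln 2 * (1/2 * log 2 q + e / ln 2)"
        by (simp add: log_def field_simps)
      finally have "N * ln 2 * ((1 - e) * r) \<le> N * ln 2 * (1/2 * log 2 q + e / ln 2)"
        by (simp add: mult_ac)
      then show ?thesis using N by (subst (asm) mult_le_cancel_left_pos) auto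
    qed
    have k1: "N * ln 2 * (R1 - e) \<le> ln M1" and k2: "N * ln 2 * (R2 - e) \<le> ln M2"
      using l1 l2 N by (auto simp: log_def field_simps)
    have "ln (real M1 * real M2) = ln M1 + ln M2" using M by (simp add: ln_mult)
    then have k12: "N * ln 2 * (R1 + R2 - 2 * e) \<le> ln (real M1 * real M2)"
      using k1 k2 by (simp add: algebra_simps)
    have "real M1 * real M2 \<ge> 1" using mult_mono[OF M] M by simp
    then have pos: "ln (real M1 * real M2) \<ge> 0" "ln M2 \<ge> 0" using M by simp_all
    from code_converse[OF P s N(1) code] scale[OF k2 pos(2)] scale[OF k12 pos(1)]
    show ?thesis unfolding c2_def c12_def by blast
  qed
  \<comment> \<open>Starting at 1/2 keeps every tolerance strictly between 0 and 1, as
    \<open>approx\<close> asks.\<close>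
  define e where "e = (\<lambda>k::nat. inverse (real (Suc (Suc k))))"
  have e: "0 < e k" "e k < 1" for k by (auto simp: e_def field_simps)
  obtain \<rho> where \<rho>: "\<And>k. \<rho> k \<in> {0..1}"
      "\<And>k. (1 - e k) * (R2 - e k) \<le> c2 (\<rho> k) + e k / ln 2"
      "\<And>k. (1 - e k) * (R1 + R2 - 2 * e k) \<le> c12 (\<rho> k) + e k / ln 2"
    using approx[OF e] by metis
  obtain l r where l: "l \<in> {0..1}" and r: "strict_mono r" and lim: "(\<rho> \<circ> r) \<longlonglongrightarrow> l"
    using compact_Icc[of "0::real" 1] \<rho>(1) unfolding compact_def by metis
  have "e \<longlonglongrightarrow> 0"
    unfolding e_def by (rule LIMSEQ_Suc[OF LIMSEQ_inverse_real_of_nat])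
  then have el: "(\<lambda>k. e (r k)) \<longlonglongrightarrow> 0"
    using r by (rule LIMSEQ_subseq_LIMSEQ[unfolded comp_def])
  have rl: "(\<lambda>k. \<rho> (r k)) \<longlonglongrightarrow> l" using lim by (simp add: comp_def)
  have l2: "l\<^sup>2 \<le> 1" using l by (simp add: power_le_one)
  have "1 + P2 * (1 - l\<^sup>2) / s > 0" "1 + (P1 + P2 + 2 * sqrt (P1 * P2) * l) / s > 0"
    using P s l l2 by (auto intro!: add_pos_nonneg)
  then have "(\<lambda>k. c2 (\<rho> (r k)) + e (r k) / ln 2) \<longlonglongrightarrow> c2 l + 0 / ln 2"
    "(\<lambda>k. c12 (\<rho> (r k)) + e (r k) / ln 2) \<longlonglongrightarrow> c12 l + 0 / ln 2"
    unfolding c2_def c12_def using s by (intro tendsto_intros rl el; simp)+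
  moreover have "(\<lambda>k. (1 - e (r k)) * (R2 - e (r k))) \<longlonglongrightarrow> (1 - 0) * (R2 - 0)"
    "(\<lambda>k. (1 - e (r k)) * (R1 + R2 - 2 * e (r k))) \<longlonglongrightarrow> (1 - 0) * (R1 + R2 - 2 * 0)"
    by (intro tendsto_intros el)+
  ultimately have "(1 - 0) * (R2 - 0) \<le> c2 l + 0 / ln 2" "(1 - 0) * (R1 + R2 - 2 * 0) \<le> c12 l + 0 / ln 2"
    using \<rho>(2,3) by (auto intro: LIMSEQ_le)
  then show ?thesis using l unfolding c2_def c12_def by auto
qed

subsection \<open>Achievability\<close>

lemma markov_square:
  assumes [measurable]: "f \<in> borel_measurable M" and f: "integrable M (\<lambda>z. (f z)\<^sup>2)" and t: "t > (0::real)"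
  shows "measure M {z \<in> space M. t \<le> \<bar>f z\<bar>} \<le> (\<integral>z. (f z)\<^sup>2 \<partial>M) / t\<^sup>2"
proof -
  have "{z \<in> space M. t \<le> \<bar>f z\<bar>} = {z \<in> space M. t\<^sup>2 \<le> (f z)\<^sup>2}"
    using t by (auto simp: abs_le_square_iff[symmetric])
  then show ?thesis
    using integral_Markov_inequality_measure[OF f, of "{}" "t\<^sup>2"] t by simp
qed

section \<open>The nested Schalkwijk-Kailath scheme\<close>

text \<open>\<open>Q\<close> is the power of the inner signal and \<open>a\<close> the amplitude
  with which both users together send the error of the first message. An output has second moment
  \<open>a\<^sup>2 + Q + s\<close>; \<open>c\<close> and \<open>k\<close> are the least-squares
  coefficients for an outer error of variance 1 and an inner error of variance \<open>Q\<close>, and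
  \<open>h\<close> and \<open>g\<close> undo the shrinking of the errors. The message points are the
  initial errors.\<close>

locale linear_feedback =
  fixes P1 P2 s \<rho> Q a h g c k :: real and \<theta>1 \<theta>2 :: "nat \<Rightarrow> real" and M1 M2 :: nat and d1 d2 :: real
  assumes P: "P1 > 0" "P2 > 0" and s: "s > 0" and \<rho>: "0 \<le> \<rho>" "\<rho> \<le> 1"
    and M: "M1 \<ge> 1" "M2 \<ge> 1"
    and Q_def: "Q = P2 * (1 - \<rho>\<^sup>2)"
    and a_def: "a = sqrt P1 + \<rho> * sqrt P2"
    and h_def: "h = sqrt ((a\<^sup>2 + Q + s) / (Q + s))"
    and g_def: "g = sqrt ((Q + s) / s)"
    and c_def: "c = a / (a\<^sup>2 + Q + s)"
    and k_def: "k = Q / (Q + s)"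
    and \<theta>1: "(\<Sum>w\<in>{1..M1}. \<theta>1 w) = 0" "(\<Sum>w\<in>{1..M1}. (\<theta>1 w)\<^sup>2) = M1"
    and \<theta>2: "(\<Sum>w\<in>{1..M2}. \<theta>2 w) = 0" "(\<Sum>w\<in>{1..M2}. (\<theta>2 w)\<^sup>2) = M2 * Q"
    and d: "d1 > 0" "d2 > 0"
    and sep1: "\<And>w w'. w \<in> {1..M1} \<Longrightarrow> w' \<in> {1..M1} \<Longrightarrow> w \<noteq> w' \<Longrightarrow> \<bar>\<theta>1 w - \<theta>1 w'\<bar> \<ge> d1"
    and sep2: "\<And>w w'. w \<in> {1..M2} \<Longrightarrow> w' \<in> {1..M2} \<Longrightarrow> w \<noteq> w' \<Longrightarrow> \<bar>\<theta>2 w - \<theta>2 w'\<bar> \<ge> d2"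
begin

text \<open>The state holds the receiver's normalised estimation errors of the two messages; each
  step subtracts the linear least-squares estimate of the error given the new output and
  rescales to the old variance.\<close>

definition step :: "real \<times> real \<Rightarrow> real \<Rightarrow> real \<times> real" where
  "step p y = (h * (fst p - c * y), g * (snd p - k * (y - a * fst p)))"

text \<open>The first user does not know the second message and starts the inner state at a dummy 0;
  by \<open>fst_foldl_step\<close> the outer state is unaffected.\<close>

definition f1 :: "nat \<Rightarrow> nat \<Rightarrow> real list \<Rightarrow> real" where
  "f1 i w1 ys = sqrt P1 * fst (foldl step (\<theta>1 w1, 0) ys)"

text \<open>The first summand adds coherently to the first user's signal; the second is the inner
  signal.\<close>

definition f2 :: "nat \<Rightarrow> nat \<Rightarrow> nat \<Rightarrow> real list \<Rightarrow> real" where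
  "f2 i w1 w2 ys = \<rho> * sqrt P2 * fst (foldl step (\<theta>1 w1, \<theta>2 w2) ys) + snd (foldl step (\<theta>1 w1, \<theta>2 w2) ys)"

definition U where "U w1 w2 i z = fst (foldl step (\<theta>1 w1, \<theta>2 w2) (chan_out f1 f2 w1 w2 z i))"
definition V where "V w1 w2 i z = snd (foldl step (\<theta>1 w1, \<theta>2 w2) (chan_out f1 f2 w1 w2 z i))"

text \<open>Every candidate is replayed against the outputs. After \<open>n\<close> outputs distinct
  candidates are at least \<open>h ^ n * d1\<close> apart, so at most one stays within half of that,
  and \<open>LEAST\<close> picks it.\<close>

definition dec1 where
  "dec1 n ys = (LEAST w. w \<in> {1..M1} \<and> \<bar>fst (foldl step (\<theta>1 w, 0) ys)\<bar> < h ^ n * d1 / 2)"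
text \<open>The inner recursion needs the outer state, so the first message is decoded beforehand
  and handed over as \<open>w1\<close>.\<close>

definition dec2 where
  "dec2 n w1 ys = (LEAST w. w \<in> {1..M2} \<and> \<bar>snd (foldl step (\<theta>1 w1, \<theta>2 w) ys)\<bar> < g ^ n * d2 / 2)"
definition psi where "psi n ys = (dec1 n ys, dec2 n (dec1 n ys) ys)"

lemma Q_nonneg: "Q \<ge> 0"
  using P \<rho> by (simp add: Q_def power_le_one)

lemma h_pos: "h > 0" and g_pos: "g > 0"
  and h_square: "h\<^sup>2 = (a\<^sup>2 + Q + s) / (Q + s)" and g_square: "g\<^sup>2 = (Q + s) / s"
  using s Q_nonneg by (simp_all add: h_def g_def add_nonneg_pos)

lemma foldl_step_snoc:
  "fst (foldl step p (ys @ [y])) = h * (fst (foldl step p ys) - c * y)"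
  "snd (foldl step p (ys @ [y])) = g * (snd (foldl step p ys) - k * (y - a * fst (foldl step p ys)))"
  by (simp_all add: step_def)

lemma fst_foldl_step: "fst (foldl step (u, v) ys) = fst (foldl step (u, v') ys)"
  by (induction ys rule: rev_induct) (simp_all only: foldl_step_snoc, simp)

text \<open>Both runs see the same outputs, so the corrections cancel and each step multiplies the
  gap by \<open>h\<close>. The candidates thus separate geometrically while the true error keeps its
  variance.\<close>

lemma fst_foldl_step_diff:
  "fst (foldl step (u, v) ys) - fst (foldl step (u', v') ys) = h ^ length ys * (u - u')"
proof (induction ys rule: rev_induct)
  case (snoc y ys)
  have "h * (A - c * y) - h * (B - c * y) = h * (A - B)" for A B by (simp add: algebra_simps)
  then show ?case unfolding foldl_step_snoc by (simp add: snoc)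
qed simp

text \<open>The inner correction contains the outer state, hence the common start \<open>u\<close>;
  it then cancels and only the factor \<open>g\<close> acts.\<close>

lemma snd_foldl_step_diff:
  "snd (foldl step (u, v) ys) - snd (foldl step (u, v') ys) = g ^ length ys * (v - v')"
proof (induction ys rule: rev_induct)
  case (snoc y ys)
  have "g * (A - e) - g * (B - e) = g * (A - B)" for A B e by (simp add: algebra_simps)
  then show ?case unfolding foldl_step_snoc fst_foldl_step[of u v ys v'] by (simp add: snoc)
qed simp

lemma length_chan_out: "length (chan_out f f' w1 w2 z n) = n"
  by (induction n) (auto simp: Let_def)

lemma X1_eq: "X1 f1 f2 w1 w2 z i = sqrt P1 * U w1 w2 i z"
  unfolding X1_def f1_def U_def by (simp add: fst_foldl_step[of _ 0 _ "\<theta>2 w2"])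

lemma X2_eq: "X2 f1 f2 w1 w2 z i = \<rho> * sqrt P2 * U w1 w2 i z + V w1 w2 i z"
  unfolding X2_def f2_def U_def V_def ..

lemma chan_out_Suc: "chan_out f1 f2 w1 w2 z (Suc i)
    = chan_out f1 f2 w1 w2 z i @ [a * U w1 w2 i z + V w1 w2 i z + z i]"
  using X1_eq[of w1 w2 z i] X2_eq[of w1 w2 z i]
  by (simp add: Let_def X1_def X2_def a_def algebra_simps)

lemma U_0: "U w1 w2 0 z = \<theta>1 w1" and V_0: "V w1 w2 0 z = \<theta>2 w2"
  by (simp_all add: U_def V_def)

lemma U_Suc: "U w1 w2 (Suc i) z = h * ((1 - c * a) * U w1 w2 i z - c * V w1 w2 i z - c * z i)"
  unfolding U_def[of _ _ "Suc i"] chan_out_Suc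
  by (simp add: step_def U_def[symmetric] V_def[symmetric] algebra_simps)

text \<open>The outer state drops out, because the output minus \<open>a * U\<close> is the inner
  state plus the noise. The inner scheme thus runs over a point-to-point channel of noise variance
  \<open>s\<close>.\<close>

lemma V_Suc: "V w1 w2 (Suc i) z = g * ((1 - k) * V w1 w2 i z - k * z i)"
  unfolding V_def[of _ _ "Suc i"] chan_out_Suc
  by (simp add: step_def U_def[symmetric] V_def[symmetric] algebra_simps)

lemma U_V_cong:
  assumes "\<And>j. j < i \<Longrightarrow> z j = z' j"
  shows "U w1 w2 i z = U w1 w2 i z'" "V w1 w2 i z = V w1 w2 i z'"
  using chan_out_cong[OF assms] by (simp_all add: U_def V_def)

lemma noise_measurable: "i < N \<Longrightarrow> (\<lambda>z. z i) \<in> borel_measurable (noise_space s N)"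
  unfolding measurable_cong_sets[OF sets_noise refl] by (intro measurable_component_singleton) simp

lemma U_V_square_integrable:
  assumes "i \<le> N"
  shows "U w1 w2 i \<in> borel_measurable (noise_space s N) \<and> V w1 w2 i \<in> borel_measurable (noise_space s N)
    \<and> integrable (noise_space s N) (\<lambda>z. (U w1 w2 i z)\<^sup>2) \<and> integrable (noise_space s N) (\<lambda>z. (V w1 w2 i z)\<^sup>2)"
  using assms
proof (induction i)
  case 0
  interpret prob_space "noise_space s N" by (rule prob_space_noise[OF s])
  show ?case using U_0 V_0 by (simp add: U_0[abs_def] V_0[abs_def])
next
  case (Suc i)
  let ?M = "noise_space s N"
  have i: "i < N" using Suc.prems by simp
  note [measurable] = noise_measurable[OF i]
  have [measurable]: "U w1 w2 i \<in> borel_measurable ?M" "V w1 w2 i \<in> borel_measurable ?M"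
    and sq: "integrable ?M (\<lambda>z. (U w1 w2 i z)\<^sup>2)" "integrable ?M (\<lambda>z. (V w1 w2 i z)\<^sup>2)" "integrable ?M (\<lambda>z. (z i)\<^sup>2)"
    using Suc integrable_noise_square[OF s i] by auto
  have mult: "integrable ?M (\<lambda>z. U w1 w2 i z * V w1 w2 i z)" "integrable ?M (\<lambda>z. U w1 w2 i z * z i)"
    "integrable ?M (\<lambda>z. V w1 w2 i z * z i)"
    by (intro integrable_mult_of_squares sq; measurable)+
  have square: "(h * (\<alpha> * u - c * v - c * t))\<^sup>2
      = h\<^sup>2 * (\<alpha>\<^sup>2 * u\<^sup>2 + c\<^sup>2 * v\<^sup>2 + c\<^sup>2 * t\<^sup>2 - 2 * \<alpha> * c * (u * v) - 2 * \<alpha> * c * (u * t) + 2 * c\<^sup>2 * (v * t))"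
    "(g * (\<beta> * v - k * t))\<^sup>2 = g\<^sup>2 * (\<beta>\<^sup>2 * v\<^sup>2 + k\<^sup>2 * t\<^sup>2 - 2 * \<beta> * k * (v * t))" for \<alpha> \<beta> u v t
    by (simp_all add: power2_eq_square algebra_simps)
  have "U w1 w2 (Suc i) \<in> borel_measurable ?M" "V w1 w2 (Suc i) \<in> borel_measurable ?M"
    unfolding U_Suc[abs_def] V_Suc[abs_def] by measurable
  moreover have "integrable ?M (\<lambda>z. (U w1 w2 (Suc i) z)\<^sup>2)" "integrable ?M (\<lambda>z. (V w1 w2 (Suc i) z)\<^sup>2)"
    unfolding U_Suc V_Suc square using sq mult by simp_all
  ultimately show ?case by simp
qed

lemmas U_meas = U_V_square_integrable[THEN conjunct1]
lemmas V_meas = U_V_square_integrable[THEN conjunct2, THEN conjunct1]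
lemmas U_sq = U_V_square_integrable[THEN conjunct2, THEN conjunct2, THEN conjunct1]
lemmas V_sq = U_V_square_integrable[THEN conjunct2, THEN conjunct2, THEN conjunct2]

lemma UV_integrable: "i \<le> N \<Longrightarrow> integrable (noise_space s N) (\<lambda>z. U w1 w2 i z * V w1 w2 i z)"
  by (intro integrable_mult_of_squares U_meas V_meas U_sq V_sq)

section \<open>Second moments of the states\<close>

text \<open>A total over message pairs, that is \<open>M1 * M2\<close> times the expectation under
  uniform messages.\<close>

definition mean :: "nat \<Rightarrow> (nat \<Rightarrow> nat \<Rightarrow> (nat \<Rightarrow> real) \<Rightarrow> real) \<Rightarrow> real" where
  "mean N f = (\<Sum>w1\<in>{1..M1}. \<Sum>w2\<in>{1..M2}. \<integral>z. f w1 w2 z \<partial>noise_space s N)"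

text \<open>The states at time \<open>i\<close> depend on noise before time \<open>i\<close>, so all
  cross terms with \<open>z i\<close> integrate to zero and the three second moments obey a closed
  linear recursion.\<close>

lemma moment_recursion:
  assumes i: "i < N"
  shows "mean N (\<lambda>w1 w2 z. (U w1 w2 (Suc i) z)\<^sup>2)
      = h\<^sup>2 * ((1 - c * a)\<^sup>2 * mean N (\<lambda>w1 w2 z. (U w1 w2 i z)\<^sup>2) + c\<^sup>2 * mean N (\<lambda>w1 w2 z. (V w1 w2 i z)\<^sup>2)
        - 2 * (1 - c * a) * c * mean N (\<lambda>w1 w2 z. U w1 w2 i z * V w1 w2 i z) + c\<^sup>2 * (M1 * M2 * s))"
    and "mean N (\<lambda>w1 w2 z. (V w1 w2 (Suc i) z)\<^sup>2)
      = g\<^sup>2 * ((1 - k)\<^sup>2 * mean N (\<lambda>w1 w2 z. (V w1 w2 i z)\<^sup>2) + k\<^sup>2 * (M1 * M2 * s))"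
    and "mean N (\<lambda>w1 w2 z. U w1 w2 (Suc i) z * V w1 w2 (Suc i) z)
      = h * g * ((1 - c * a) * (1 - k) * mean N (\<lambda>w1 w2 z. U w1 w2 i z * V w1 w2 i z)
        - c * (1 - k) * mean N (\<lambda>w1 w2 z. (V w1 w2 i z)\<^sup>2) + c * k * (M1 * M2 * s))"
proof -
  let ?M = "noise_space s N"
  have iN: "i \<le> N" using i by simp
  have indep: "U w1 w2 i (z(i := t)) = U w1 w2 i z" "V w1 w2 i (z(i := t)) = V w1 w2 i z" for w1 w2 z t
    by (intro U_V_cong; simp)+
  note Uz = integrable_mult_noise[OF s i U_meas[OF iN] U_sq[OF iN] indep(1)]
    integral_mult_noise[OF s i U_meas[OF iN] U_sq[OF iN] indep(1)]
  note Vz = integrable_mult_noise[OF s i V_meas[OF iN] V_sq[OF iN] indep(2)]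
    integral_mult_noise[OF s i V_meas[OF iN] V_sq[OF iN] indep(2)]
  note int = U_sq[OF iN] V_sq[OF iN] UV_integrable[OF iN] Uz Vz
    integrable_noise_square[OF s i] integral_noise_square[OF s i]
  have square: "(h * (\<alpha> * u - c * v - c * t))\<^sup>2
      = h\<^sup>2 * (\<alpha>\<^sup>2 * u\<^sup>2 + c\<^sup>2 * v\<^sup>2 + c\<^sup>2 * t\<^sup>2 - 2 * \<alpha> * c * (u * v) - 2 * \<alpha> * c * (u * t) + 2 * c\<^sup>2 * (v * t))"
    "(g * (\<beta> * v - k * t))\<^sup>2 = g\<^sup>2 * (\<beta>\<^sup>2 * v\<^sup>2 + k\<^sup>2 * t\<^sup>2 - 2 * \<beta> * k * (v * t))"
    "(h * (\<alpha> * u - c * v - c * t)) * (g * (\<beta> * v - k * t))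
      = h * g * (\<alpha> * \<beta> * (u * v) - c * \<beta> * v\<^sup>2 + c * k * t\<^sup>2 - \<alpha> * k * (u * t) + (c * k - c * \<beta>) * (v * t))" for \<alpha> \<beta> u v t
    by (simp_all add: power2_eq_square algebra_simps)
  have "(\<integral>z. (U w1 w2 (Suc i) z)\<^sup>2 \<partial>?M)
      = h\<^sup>2 * ((1 - c * a)\<^sup>2 * (\<integral>z. (U w1 w2 i z)\<^sup>2 \<partial>?M) + c\<^sup>2 * (\<integral>z. (V w1 w2 i z)\<^sup>2 \<partial>?M)
        - 2 * (1 - c * a) * c * (\<integral>z. U w1 w2 i z * V w1 w2 i z \<partial>?M) + c\<^sup>2 * s)" for w1 w2
    unfolding U_Suc square using int by simp
  then show "mean N (\<lambda>w1 w2 z. (U w1 w2 (Suc i) z)\<^sup>2)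
      = h\<^sup>2 * ((1 - c * a)\<^sup>2 * mean N (\<lambda>w1 w2 z. (U w1 w2 i z)\<^sup>2) + c\<^sup>2 * mean N (\<lambda>w1 w2 z. (V w1 w2 i z)\<^sup>2)
        - 2 * (1 - c * a) * c * mean N (\<lambda>w1 w2 z. U w1 w2 i z * V w1 w2 i z) + c\<^sup>2 * (M1 * M2 * s))"
    by (simp add: mean_def sum.distrib sum_subtractf sum_distrib_left[symmetric])
  have "(\<integral>z. (V w1 w2 (Suc i) z)\<^sup>2 \<partial>?M) = g\<^sup>2 * ((1 - k)\<^sup>2 * (\<integral>z. (V w1 w2 i z)\<^sup>2 \<partial>?M) + k\<^sup>2 * s)" for w1 w2
    unfolding V_Suc square using int by simp
  then show "mean N (\<lambda>w1 w2 z. (V w1 w2 (Suc i) z)\<^sup>2)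
      = g\<^sup>2 * ((1 - k)\<^sup>2 * mean N (\<lambda>w1 w2 z. (V w1 w2 i z)\<^sup>2) + k\<^sup>2 * (M1 * M2 * s))"
    by (simp add: mean_def sum.distrib sum_subtractf sum_distrib_left[symmetric])
  have "(\<integral>z. U w1 w2 (Suc i) z * V w1 w2 (Suc i) z \<partial>?M)
      = h * g * ((1 - c * a) * (1 - k) * (\<integral>z. U w1 w2 i z * V w1 w2 i z \<partial>?M)
        - c * (1 - k) * (\<integral>z. (V w1 w2 i z)\<^sup>2 \<partial>?M) + c * k * s)" for w1 w2
    unfolding U_Suc V_Suc square using int by simp
  then show "mean N (\<lambda>w1 w2 z. U w1 w2 (Suc i) z * V w1 w2 (Suc i) z)
      = h * g * ((1 - c * a) * (1 - k) * mean N (\<lambda>w1 w2 z. U w1 w2 i z * V w1 w2 i z)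
        - c * (1 - k) * mean N (\<lambda>w1 w2 z. (V w1 w2 i z)\<^sup>2) + c * k * (M1 * M2 * s))"
    by (simp add: mean_def sum.distrib sum_subtractf sum_distrib_left[symmetric])
qed

text \<open>Outer variance 1, inner variance \<open>Q\<close> and correlation zero form a fixed
  point of the recursion. Correlation zero survives because the new inner error is orthogonal to
  \<open>V + z\<close>, the only combination in which inner state and noise enter the new outer
  state.\<close>

lemma moments:
  assumes "i \<le> N"
  shows "mean N (\<lambda>w1 w2 z. (U w1 w2 i z)\<^sup>2) = M1 * M2 \<and> mean N (\<lambda>w1 w2 z. (V w1 w2 i z)\<^sup>2) = M1 * M2 * Q
    \<and> mean N (\<lambda>w1 w2 z. U w1 w2 i z * V w1 w2 i z) = 0"
  using assms
proof (induction i)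
  case 0
  interpret prob_space "noise_space s N" by (rule prob_space_noise[OF s])
  \<comment> \<open>The initial correlation factors over the two messages and vanishes since the
    points are centered.\<close>
  have "(\<Sum>w1\<in>{1..M1}. \<Sum>w2\<in>{1..M2}. \<theta>1 w1 * \<theta>2 w2) = 0"
    unfolding sum_product[symmetric] \<theta>1 by simp
  then show ?case
    using \<theta>1 \<theta>2 by (simp add: mean_def U_0 V_0 prob_space sum_distrib_right[symmetric] sum_distrib_left[symmetric] del: One_nat_def)
next
  case (Suc i)
  then have i: "i < N" and U2: "mean N (\<lambda>w1 w2 z. (U w1 w2 i z)\<^sup>2) = M1 * M2"
    and V2: "mean N (\<lambda>w1 w2 z. (V w1 w2 i z)\<^sup>2) = M1 * M2 * Q"
    and UV: "mean N (\<lambda>w1 w2 z. U w1 w2 i z * V w1 w2 i z) = 0" by auto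
  define T where "T = Q + s"
  define D where "D = a\<^sup>2 + T"
  have T: "T > 0" and D: "D > 0" using s Q_nonneg by (auto simp: T_def D_def add_nonneg_pos)
  have ca: "1 - c * a = T / D" using D by (simp add: c_def D_def T_def power2_eq_square field_simps)
  have c: "c = a / D" by (simp add: c_def D_def T_def)
  have k1: "1 - k = s / T" and k: "k = Q / T" using T by (simp_all add: k_def T_def field_simps)
  have h2: "h\<^sup>2 = D / T" and g2: "g\<^sup>2 = T / s" by (simp_all add: h_square g_square D_def T_def)
  have "D / T * ((T / D)\<^sup>2 + (a / D)\<^sup>2 * T) = (T + a\<^sup>2) / D"
    using T D by (simp add: power2_eq_square field_simps)
  also have "\<dots> = 1" using D by (simp add: D_def)
  finally have e1: "h\<^sup>2 * ((1 - c * a)\<^sup>2 + c\<^sup>2 * (Q + s)) = 1"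
    unfolding ca unfolding c h2 T_def .
  have "T / s * ((s / T)\<^sup>2 * Q + (Q / T)\<^sup>2 * s) = Q * (Q + s) / T"
    using T s by (simp add: power2_eq_square field_simps)
  also have "\<dots> = Q" using T by (simp add: T_def)
  finally have e2: "g\<^sup>2 * ((1 - k)\<^sup>2 * Q + k\<^sup>2 * s) = Q"
    unfolding k1 unfolding k g2 .
  \<comment> \<open>Orthogonality of \<open>(1 - k) * V - k * z\<close> to \<open>V + z\<close>, up
    to the factor \<open>-c\<close>.\<close>
  have e3: "c * k * s - c * (1 - k) * Q = 0" unfolding k1 unfolding k by simp
  have "mean N (\<lambda>w1 w2 z. (U w1 w2 (Suc i) z)\<^sup>2) = M1 * M2 * (h\<^sup>2 * ((1 - c * a)\<^sup>2 + c\<^sup>2 * (Q + s)))"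
    unfolding moment_recursion[OF i] U2 V2 UV by (simp add: algebra_simps)
  moreover have "mean N (\<lambda>w1 w2 z. (V w1 w2 (Suc i) z)\<^sup>2) = M1 * M2 * (g\<^sup>2 * ((1 - k)\<^sup>2 * Q + k\<^sup>2 * s))"
    unfolding moment_recursion[OF i] V2 by (simp add: algebra_simps)
  moreover have "mean N (\<lambda>w1 w2 z. U w1 w2 (Suc i) z * V w1 w2 (Suc i) z)
      = h * g * (M1 * M2) * (c * k * s - c * (1 - k) * Q)"
    unfolding moment_recursion[OF i] V2 UV by (simp add: algebra_simps)
  ultimately show ?case unfolding e1 e2 e3 by simp
qed

lemma nn_integral_mean:
  assumes "\<And>w1 w2 z. f w1 w2 z \<ge> 0" "\<And>w1 w2. integrable (noise_space s N) (f w1 w2)"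
  shows "(\<Sum>w1\<in>{1..M1}. \<Sum>w2\<in>{1..M2}. \<integral>\<^sup>+z. ennreal (f w1 w2 z) \<partial>noise_space s N) = ennreal (mean N f)"
  unfolding mean_def using assms
  by (simp add: nn_integral_eq_integral sum_nonneg)

text \<open>By stationarity every instant spends exactly the allowed power; for the second user the
  coherent part takes \<open>\<rho>\<^sup>2 * P2\<close> and the inner signal the remaining
  \<open>Q\<close>.\<close>

lemma transmit_power:
  assumes i: "i \<le> N"
  shows "(\<Sum>w1\<in>{1..M1}. \<Sum>w2\<in>{1..M2}. \<integral>\<^sup>+z. ennreal ((X1 f1 f2 w1 w2 z i)\<^sup>2) \<partial>noise_space s N) = ennreal (M1 * M2 * P1)"
    and "(\<Sum>w1\<in>{1..M1}. \<Sum>w2\<in>{1..M2}. \<integral>\<^sup>+z. ennreal ((X2 f1 f2 w1 w2 z i)\<^sup>2) \<partial>noise_space s N) = ennreal (M1 * M2 * P2)"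
proof -
  note int = U_sq[OF i] V_sq[OF i] UV_integrable[OF i]
  have "mean N (\<lambda>w1 w2 z. (X1 f1 f2 w1 w2 z i)\<^sup>2) = P1 * mean N (\<lambda>w1 w2 z. (U w1 w2 i z)\<^sup>2)"
    using P by (simp add: mean_def X1_eq power_mult_distrib sum_distrib_left)
  then have "mean N (\<lambda>w1 w2 z. (X1 f1 f2 w1 w2 z i)\<^sup>2) = M1 * M2 * P1"
    by (simp add: moments[OF i])
  then show "(\<Sum>w1\<in>{1..M1}. \<Sum>w2\<in>{1..M2}. \<integral>\<^sup>+z. ennreal ((X1 f1 f2 w1 w2 z i)\<^sup>2) \<partial>noise_space s N) = ennreal (M1 * M2 * P1)"
    using int by (subst nn_integral_mean) (auto simp: X1_eq power_mult_distrib)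
  have sq: "(X2 f1 f2 w1 w2 z i)\<^sup>2 = \<rho>\<^sup>2 * P2 * (U w1 w2 i z)\<^sup>2 + 2 * \<rho> * sqrt P2 * (U w1 w2 i z * V w1 w2 i z) + (V w1 w2 i z)\<^sup>2" for w1 w2 z
    using P by (simp add: X2_eq power2_sum power_mult_distrib)
  have "mean N (\<lambda>w1 w2 z. (X2 f1 f2 w1 w2 z i)\<^sup>2)
    = \<rho>\<^sup>2 * P2 * mean N (\<lambda>w1 w2 z. (U w1 w2 i z)\<^sup>2) + 2 * \<rho> * sqrt P2 * mean N (\<lambda>w1 w2 z. U w1 w2 i z * V w1 w2 i z)
      + mean N (\<lambda>w1 w2 z. (V w1 w2 i z)\<^sup>2)"
    unfolding sq using int by (simp add: mean_def sum.distrib sum_distrib_left)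
  also have "\<dots> = M1 * M2 * P2"
    by (simp add: moments[OF i] Q_def algebra_simps)
  finally have mean: "mean N (\<lambda>w1 w2 z. (X2 f1 f2 w1 w2 z i)\<^sup>2) = M1 * M2 * P2" .
  have "integrable (noise_space s N) (\<lambda>z. (X2 f1 f2 w1 w2 z i)\<^sup>2)" for w1 w2
    unfolding sq using int by simp
  from nn_integral_mean[of "\<lambda>w1 w2 z. (X2 f1 f2 w1 w2 z i)\<^sup>2" N, OF zero_le_power2 this]
  show "(\<Sum>w1\<in>{1..M1}. \<Sum>w2\<in>{1..M2}. \<integral>\<^sup>+z. ennreal ((X2 f1 f2 w1 w2 z i)\<^sup>2) \<partial>noise_space s N) = ennreal (M1 * M2 * P2)"
    by (simp only: mean)
qed

section \<open>Decoding and error probability\<close>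

text \<open>The start \<open>p\<close> is arbitrary since the decoder also replays candidates other
  than the true messages.\<close>

lemma foldl_step_measurable:
  assumes "n \<le> N"
  shows "(\<lambda>z. fst (foldl step p (chan_out f1 f2 w1 w2 z n))) \<in> borel_measurable (noise_space s N)
    \<and> (\<lambda>z. snd (foldl step p (chan_out f1 f2 w1 w2 z n))) \<in> borel_measurable (noise_space s N)"
  using assms
proof (induction n)
  case (Suc n)
  then have n: "n < N" "n \<le> N" by auto
  note [measurable] = noise_measurable[OF n(1)] U_meas[OF n(2)] V_meas[OF n(2)]
    Suc.IH[OF n(2), THEN conjunct1] Suc.IH[OF n(2), THEN conjunct2]
  show ?case unfolding chan_out_Suc foldl_step_snoc
    by (intro conjI; measurable)
qed simp

lemma psi_measurable: "(\<lambda>z. psi N (chan_out f1 f2 w1 w2 z N)) \<in> measurable (noise_space s N) (count_space UNIV)"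
proof -
  let ?M = "noise_space s N"
  note [measurable] = foldl_step_measurable[OF order_refl, THEN conjunct1] foldl_step_measurable[OF order_refl, THEN conjunct2]
  have [measurable]: "(\<lambda>z. dec1 N (chan_out f1 f2 w1 w2 z N)) \<in> measurable ?M (count_space UNIV)"
    unfolding dec1_def by measurable
  have [measurable]: "(\<lambda>z. dec2 N w (chan_out f1 f2 w1 w2 z N)) \<in> measurable ?M (count_space UNIV)" for w
    unfolding dec2_def by measurable
  \<comment> \<open>The first decision takes countably many values, so the second is treated for
    each value separately.\<close>
  have "(\<lambda>z. dec2 N (dec1 N (chan_out f1 f2 w1 w2 z N)) (chan_out f1 f2 w1 w2 z N)) \<in> measurable ?M (count_space UNIV)"
    by (rule measurable_compose_countable[where f="\<lambda>w z. dec2 N w (chan_out f1 f2 w1 w2 z N)"]) measurable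
  then show ?thesis unfolding psi_def by measurable
qed

text \<open>If both true errors stay below half the separation, the triangle inequality excludes
  every other candidate.\<close>

lemma psi_correct:
  assumes w: "w1 \<in> {1..M1}" "w2 \<in> {1..M2}"
    and U: "\<bar>U w1 w2 N z\<bar> < h ^ N * d1 / 2" and V: "\<bar>V w1 w2 N z\<bar> < g ^ N * d2 / 2"
  shows "psi N (chan_out f1 f2 w1 w2 z N) = (w1, w2)"
proof -
  let ?ys = "chan_out f1 f2 w1 w2 z N"
  have 1: "\<bar>fst (foldl step (\<theta>1 w1, 0) ?ys)\<bar> < h ^ N * d1 / 2"
    using U unfolding U_def by (simp add: fst_foldl_step[of _ 0 _ "\<theta>2 w2"])
  have "dec1 N ?ys = w1"
    unfolding dec1_def
  proof (rule Least_equality)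
    show "w1 \<in> {1..M1} \<and> \<bar>fst (foldl step (\<theta>1 w1, 0) ?ys)\<bar> < h ^ N * d1 / 2" using w 1 by simp
  next
    fix w assume w': "w \<in> {1..M1} \<and> \<bar>fst (foldl step (\<theta>1 w, 0) ?ys)\<bar> < h ^ N * d1 / 2"
    have "\<bar>h ^ N * (\<theta>1 w - \<theta>1 w1)\<bar> < h ^ N * d1"
      using w' 1 fst_foldl_step_diff[of "\<theta>1 w" 0 ?ys "\<theta>1 w1" 0] unfolding length_chan_out by linarith
    then have "\<bar>\<theta>1 w - \<theta>1 w1\<bar> < d1" using h_pos by (simp add: abs_mult)
    then have "w = w1" using sep1[of w w1] w w' by force
    then show "w1 \<le> w" by simp
  qed
  moreover have "dec2 N w1 ?ys = w2"
    unfolding dec2_def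
  proof (rule Least_equality)
    show "w2 \<in> {1..M2} \<and> \<bar>snd (foldl step (\<theta>1 w1, \<theta>2 w2) ?ys)\<bar> < g ^ N * d2 / 2"
      using w V by (simp add: V_def)
  next
    fix w assume w': "w \<in> {1..M2} \<and> \<bar>snd (foldl step (\<theta>1 w1, \<theta>2 w) ?ys)\<bar> < g ^ N * d2 / 2"
    have "\<bar>g ^ N * (\<theta>2 w - \<theta>2 w2)\<bar> < g ^ N * d2"
      using w' V snd_foldl_step_diff[of "\<theta>1 w1" "\<theta>2 w" ?ys "\<theta>2 w2"] unfolding length_chan_out V_def by linarith
    then have "\<bar>\<theta>2 w - \<theta>2 w2\<bar> < d2" using g_pos by (simp add: abs_mult)
    then have "w = w2" using sep2[of w w2] w w' by force
    then show "w2 \<le> w" by simp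
  qed
  ultimately show ?thesis by (simp add: psi_def)
qed

text \<open>Union bound and Chebyshev's inequality at the decoder's thresholds: the error variances
  stay at 1 and \<open>Q\<close> while the squared thresholds grow geometrically.\<close>

lemma err_prob_le: "err_prob s N M1 M2 f1 f2 (psi N) \<le> 4 / (d1\<^sup>2 * ((a\<^sup>2 + Q + s) / (Q + s)) ^ N) + 4 * Q / (d2\<^sup>2 * ((Q + s) / s) ^ N)"
proof -
  let ?M = "noise_space s N"
  interpret prob_space ?M by (rule prob_space_noise[OF s])
  define t1 where "t1 = h ^ N * d1 / 2"
  define t2 where "t2 = g ^ N * d2 / 2"
  have t: "t1 > 0" "t2 > 0" using h_pos g_pos d by (simp_all add: t1_def t2_def)
  have "measure ?M {z \<in> space ?M. psi N (chan_out f1 f2 w1 w2 z N) \<noteq> (w1, w2)}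
      \<le> (\<integral>z. (U w1 w2 N z)\<^sup>2 \<partial>?M) / t1\<^sup>2 + (\<integral>z. (V w1 w2 N z)\<^sup>2 \<partial>?M) / t2\<^sup>2"
    if w: "w1 \<in> {1..M1}" "w2 \<in> {1..M2}" for w1 w2
  proof -
    note [measurable] = U_meas[OF order_refl, of w1 w2 N] V_meas[OF order_refl, of w1 w2 N]
    have "measure ?M {z \<in> space ?M. psi N (chan_out f1 f2 w1 w2 z N) \<noteq> (w1, w2)}
      \<le> measure ?M ({z \<in> space ?M. t1 \<le> \<bar>U w1 w2 N z\<bar>} \<union> {z \<in> space ?M. t2 \<le> \<bar>V w1 w2 N z\<bar>})"
    proof (rule finite_measure_mono)
      show "{z \<in> space ?M. psi N (chan_out f1 f2 w1 w2 z N) \<noteq> (w1, w2)}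
        \<subseteq> {z \<in> space ?M. t1 \<le> \<bar>U w1 w2 N z\<bar>} \<union> {z \<in> space ?M. t2 \<le> \<bar>V w1 w2 N z\<bar>}"
        using psi_correct[OF w, of N] unfolding t1_def t2_def by force
    qed measurable
    also have "\<dots> \<le> measure ?M {z \<in> space ?M. t1 \<le> \<bar>U w1 w2 N z\<bar>} + measure ?M {z \<in> space ?M. t2 \<le> \<bar>V w1 w2 N z\<bar>}"
      by (rule measure_Un_le) measurable
    also have "\<dots> \<le> (\<integral>z. (U w1 w2 N z)\<^sup>2 \<partial>?M) / t1\<^sup>2 + (\<integral>z. (V w1 w2 N z)\<^sup>2 \<partial>?M) / t2\<^sup>2"
      by (intro add_mono markov_square U_sq V_sq t order_refl) measurable
    finally show ?thesis .
  qed
  then have "(\<Sum>w1\<in>{1..M1}. \<Sum>w2\<in>{1..M2}. measure ?M {z \<in> space ?M. psi N (chan_out f1 f2 w1 w2 z N) \<noteq> (w1, w2)})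
    \<le> (\<Sum>w1\<in>{1..M1}. \<Sum>w2\<in>{1..M2}. (\<integral>z. (U w1 w2 N z)\<^sup>2 \<partial>?M) / t1\<^sup>2 + (\<integral>z. (V w1 w2 N z)\<^sup>2 \<partial>?M) / t2\<^sup>2)"
    by (intro sum_mono)
  also have "\<dots> = mean N (\<lambda>w1 w2 z. (U w1 w2 N z)\<^sup>2) / t1\<^sup>2 + mean N (\<lambda>w1 w2 z. (V w1 w2 N z)\<^sup>2) / t2\<^sup>2"
    unfolding mean_def sum_divide_distrib by (simp add: sum.distrib)
  also have "\<dots> = (M1 * M2) * (1 / t1\<^sup>2 + Q / t2\<^sup>2)"
    using moments[of N N] by (simp add: field_simps)
  finally have "err_prob s N M1 M2 f1 f2 (psi N) \<le> 1 / t1\<^sup>2 + Q / t2\<^sup>2"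
    using M unfolding err_prob_def by (simp add: divide_le_eq mult.commute)
  moreover have "t1\<^sup>2 = d1\<^sup>2 * ((a\<^sup>2 + Q + s) / (Q + s)) ^ N / 4" "t2\<^sup>2 = d2\<^sup>2 * ((Q + s) / s) ^ N / 4"
    unfolding t1_def t2_def h_square[symmetric] g_square[symmetric]
    by (simp_all add: power_mult_distrib power_divide flip: power_mult) (simp_all add: mult.commute)
  ultimately show ?thesis by (simp add: mult.commute[of Q])
qed

lemma fb_code_linear: "fb_code P1 P2 s N M1 M2 f1 f2 (psi N)"
proof -
  have "(\<lambda>z. X1 f1 f2 w1 w2 z i) \<in> borel_measurable (noise_space s N)"
    "(\<lambda>z. X2 f1 f2 w1 w2 z i) \<in> borel_measurable (noise_space s N)" if "i < N" for i w1 w2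
    using U_meas[of i N w1 w2] V_meas[of i N w1 w2] that unfolding X1_eq X2_eq by simp_all
  moreover have "(\<Sum>i<N. \<Sum>w1\<in>{1..M1}. \<Sum>w2\<in>{1..M2}. \<integral>\<^sup>+z. ennreal ((X1 f1 f2 w1 w2 z i)\<^sup>2) \<partial>noise_space s N)
     = (\<Sum>i<N. ennreal (M1 * M2 * P1))"
    by (intro sum.cong refl transmit_power) simp
  moreover have "(\<Sum>i<N. \<Sum>w1\<in>{1..M1}. \<Sum>w2\<in>{1..M2}. \<integral>\<^sup>+z. ennreal ((X2 f1 f2 w1 w2 z i)\<^sup>2) \<partial>noise_space s N)
     = (\<Sum>i<N. ennreal (M1 * M2 * P2))"
    by (intro sum.cong refl transmit_power) simp
  moreover have "(\<Sum>i<N. ennreal (M1 * M2 * p)) = ennreal (real N * real M1 * real M2 * p)" if "p > 0" for p :: real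
    using that by (subst sum_ennreal) (auto simp: mult_ac)
  ultimately show ?thesis
    unfolding fb_code_def using M P psi_measurable by simp
qed

end

section \<open>Equally spaced message points\<close>

lemma sum_centered:
  "(\<Sum>w\<in>{1..M}. 2 * real w - M - 1) = 0"
  "(\<Sum>w\<in>{1..M}. (2 * real w - M - 1)\<^sup>2) = M * (real M ^ 2 - 1) / 3"
proof -
  have 1: "(\<Sum>w\<in>{1..M}. real w) = M * (M + 1) / 2" by (induction M) (simp_all add: field_simps)
  have 2: "(\<Sum>w\<in>{1..M}. (real w)\<^sup>2) = M * (M + 1) * (2 * M + 1) / 6"
    by (induction M) (simp_all add: field_simps power2_eq_square)
  have "(\<Sum>w\<in>{1..M}. 2 * real w - M - 1) = 2 * (\<Sum>w\<in>{1..M}. real w) - M * (real M + 1)"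
    by (simp add: sum_subtractf sum_distrib_left algebra_simps)
  then show "(\<Sum>w\<in>{1..M}. 2 * real w - M - 1) = 0"
    unfolding 1 by (simp add: field_simps)
  have "(2 * real w - M - 1)\<^sup>2 = 4 * (real w)\<^sup>2 - 4 * (M + 1) * real w + (real M + 1)\<^sup>2" for w
    by (simp add: power2_eq_square algebra_simps)
  then have "(\<Sum>w\<in>{1..M}. (2 * real w - M - 1)\<^sup>2)
    = 4 * (\<Sum>w\<in>{1..M}. (real w)\<^sup>2) - 4 * (M + 1) * (\<Sum>w\<in>{1..M}. real w) + M * (real M + 1)\<^sup>2"
    by (simp add: sum.distrib sum_subtractf sum_distrib_left)
  then show "(\<Sum>w\<in>{1..M}. (2 * real w - M - 1)\<^sup>2) = M * (real M ^ 2 - 1) / 3"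
    unfolding 1 2 by (simp add: field_simps power2_eq_square)
qed

text \<open>Pulse amplitude modulation: the symmetric grid of \<open>sum_centered\<close> scaled to
  energy \<open>Q\<close>. The last clause bounds the constant that Chebyshev's inequality leaves in
  \<open>err_prob_le\<close> by a quadratic in the number of points.\<close>

lemma pam:
  assumes M: "M \<ge> 2" and Q: "Q > 0"
  shows "\<exists>(\<theta> :: nat \<Rightarrow> real) d. d > 0 \<and> (\<Sum>w\<in>{1..M}. \<theta> w) = 0 \<and> (\<Sum>w\<in>{1..M}. (\<theta> w)\<^sup>2) = M * Q \<and>
    (\<forall>w w'. w \<noteq> w' \<longrightarrow> \<bar>\<theta> w - \<theta> w'\<bar> \<ge> d) \<and> 4 * Q / d\<^sup>2 \<le> (real M)\<^sup>2 / 3"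
proof -
  have M2: "(real M)\<^sup>2 > 1" using M by (simp add: one_less_power)
  define \<kappa> where "\<kappa> = sqrt (3 * Q / (real M ^ 2 - 1))"
  have \<kappa>: "\<kappa> > 0" "\<kappa>\<^sup>2 = 3 * Q / (real M ^ 2 - 1)" using M2 Q by (simp_all add: \<kappa>_def)
  show ?thesis
  proof (rule exI[of _ "\<lambda>w. \<kappa> * (2 * real w - M - 1)"], rule exI[of _ "2 * \<kappa>"], intro conjI allI impI)
    show "(\<Sum>w\<in>{1..M}. \<kappa> * (2 * real w - M - 1)) = 0"
      unfolding sum_distrib_left[symmetric] sum_centered by simp
    show "(\<Sum>w\<in>{1..M}. (\<kappa> * (2 * real w - M - 1))\<^sup>2) = M * Q"
      unfolding power_mult_distrib sum_distrib_left[symmetric] sum_centered \<kappa>(2) using M2 by (simp add: field_simps)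
    show "\<bar>\<kappa> * (2 * real w - M - 1) - \<kappa> * (2 * real w' - M - 1)\<bar> \<ge> 2 * \<kappa>" if "w \<noteq> w'" for w w'
    proof -
      have "\<kappa> * (2 * real w - M - 1) - \<kappa> * (2 * real w' - M - 1) = 2 * \<kappa> * (real w - real w')"
        by (simp add: algebra_simps)
      moreover have "1 \<le> \<bar>real w - real w'\<bar>" using that by linarith
      ultimately show ?thesis using \<kappa>(1) by (simp add: abs_mult)
    qed
    have "4 * Q / (2 * \<kappa>)\<^sup>2 = (real M ^ 2 - 1) / 3"
      unfolding power_mult_distrib \<kappa>(2) using M2 Q by (simp add: field_simps)
    then show "4 * Q / (2 * \<kappa>)\<^sup>2 \<le> (real M)\<^sup>2 / 3" by simp
  qed (use \<kappa> in simp)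
qed

text \<open>For rho = 1 the inner signal vanishes, so its exact second moment Q = 0 forces a single message.\<close>

lemma linear_feedback_code:
  assumes P: "P1 > 0" "P2 > 0" and s: "s > 0" and \<rho>: "0 \<le> \<rho>" "\<rho> \<le> 1"
    and M1: "M1 \<ge> 2" and M2: "if \<rho> = 1 then M2 = 1 else M2 \<ge> 2"
    and G: "G = 1 + P2 * (1 - \<rho>\<^sup>2) / s" and H: "G * H = 1 + (P1 + P2 + 2 * sqrt (P1 * P2) * \<rho>) / s"
  shows "\<exists>f1 f2 psi. fb_code P1 P2 s N M1 M2 f1 f2 psi \<and>
    err_prob s N M1 M2 f1 f2 psi \<le> (real M1)\<^sup>2 / 3 / H ^ N + (if \<rho> = 1 then 0 else (real M2)\<^sup>2 / 3 / G ^ N)"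
proof -
  define Q where "Q = P2 * (1 - \<rho>\<^sup>2)"
  define a where "a = sqrt P1 + \<rho> * sqrt P2"
  have Q: "Q \<ge> 0" using P \<rho> by (simp add: Q_def power_le_one)
  obtain \<theta>1 d1 where "d1 > 0" "(\<Sum>w\<in>{1..M1}. \<theta>1 w) = 0" "(\<Sum>w\<in>{1..M1}. (\<theta>1 w)\<^sup>2) = real M1 * 1"
    "\<And>w w'. w \<noteq> w' \<Longrightarrow> \<bar>\<theta>1 w - \<theta>1 w'\<bar> \<ge> (d1::real)" "4 * 1 / d1\<^sup>2 \<le> (real M1)\<^sup>2 / 3"
    using pam[OF M1 zero_less_one] by blast
  note 1 = this[unfolded mult_1_right]
  obtain \<theta>2 d2 where 2: "d2 > 0" "(\<Sum>w\<in>{1..M2}. \<theta>2 w) = 0" "(\<Sum>w\<in>{1..M2}. (\<theta>2 w)\<^sup>2) = M2 * Q"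
    "\<And>w w'. w \<in> {1..M2} \<Longrightarrow> w' \<in> {1..M2} \<Longrightarrow> w \<noteq> w' \<Longrightarrow> \<bar>\<theta>2 w - \<theta>2 w'\<bar> \<ge> (d2::real)"
    "4 * Q / d2\<^sup>2 \<le> (if \<rho> = 1 then 0 else (real M2)\<^sup>2 / 3)"
  proof (cases "\<rho> = 1")
    case True
    \<comment> \<open>A single message leaves no pair to separate, so the spacing 1 is
      arbitrary.\<close>
    then show thesis using M2 by (intro that[of 1 "\<lambda>_. 0"]) (auto simp: Q_def)
  next
    case False
    then have "\<rho>\<^sup>2 < 1" using \<rho> by (simp add: power_less_one_iff abs_square_less_1)
    then have "Q > 0" using P by (simp add: Q_def)
    moreover have "M2 \<ge> 2" using M2 False by simp
    ultimately obtain \<theta> d where "d > 0" "(\<Sum>w\<in>{1..M2}. \<theta> w) = 0" "(\<Sum>w\<in>{1..M2}. (\<theta> w)\<^sup>2) = M2 * Q"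
      "\<And>w w'. w \<noteq> w' \<Longrightarrow> \<bar>\<theta> w - \<theta> w'\<bar> \<ge> (d::real)" "4 * Q / d\<^sup>2 \<le> (real M2)\<^sup>2 / 3"
      using pam[of M2 Q] by blast
    then show thesis using False by (intro that[of d \<theta>]) auto
  qed
  have G': "G = (Q + s) / s" using s by (simp add: G Q_def field_simps)
  \<comment> \<open>The received signal power, coherent part plus inner part. It identifies
    \<open>H\<close> as the squared growth factor of the outer scheme, which sees noise of variance
    \<open>Q + s\<close>.\<close>
  have "a\<^sup>2 + Q = P1 + P2 + 2 * sqrt (P1 * P2) * \<rho>"
    using P by (simp add: a_def Q_def power2_sum power_mult_distrib real_sqrt_mult algebra_simps)
  then have "G * H = (a\<^sup>2 + Q + s) / s" using s by (simp add: H field_simps)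
  then have H': "H = (a\<^sup>2 + Q + s) / (Q + s)" using s Q unfolding G' by (simp add: field_simps)
  interpret linear_feedback P1 P2 s \<rho> Q a "sqrt ((a\<^sup>2 + Q + s) / (Q + s))" "sqrt ((Q + s) / s)"
    "a / (a\<^sup>2 + Q + s)" "Q / (Q + s)" \<theta>1 \<theta>2 M1 M2 d1 d2
    using P s \<rho> 1 2 M1 M2 by unfold_locales (auto simp: Q_def a_def split: if_splits)
  have pos: "G > 0" "H > 0" unfolding G' H' using Q s by (simp_all add: add_nonneg_pos)
  have "4 / (d1\<^sup>2 * H ^ N) \<le> (real M1)\<^sup>2 / 3 / H ^ N"
    using divide_right_mono[OF 1(5), of "H ^ N"] pos by simp
  moreover have "4 * Q / (d2\<^sup>2 * G ^ N) \<le> (if \<rho> = 1 then 0 else (real M2)\<^sup>2 / 3 / G ^ N)"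
    using divide_right_mono[OF 2(5), of "G ^ N"] pos by (simp split: if_splits)
  ultimately have "err_prob s N M1 M2 f1 f2 (psi N) \<le> (real M1)\<^sup>2 / 3 / H ^ N + (if \<rho> = 1 then 0 else (real M2)\<^sup>2 / 3 / G ^ N)"
    using err_prob_le[of N] unfolding G'[symmetric] H'[symmetric] by linarith
  then show ?thesis using fb_code_linear by blast
qed

section \<open>Codebook sizes and achievable rates\<close>

text \<open>The added 1 guarantees two points even at rate 0, as \<open>pam\<close>
  requires.\<close>

definition codebook_size :: "real \<Rightarrow> nat \<Rightarrow> nat" where
  "codebook_size r N = nat \<lceil>2 powr (N * r)\<rceil> + 1"

lemma codebook_size:
  assumes r: "r \<ge> 0"
  shows "codebook_size r N \<ge> 2" and "N > 0 \<Longrightarrow> log 2 (codebook_size r N) / N \<ge> r"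
    and "(real (codebook_size r N))\<^sup>2 / 3 \<le> 3 * (2 powr (2 * r)) ^ N"
proof -
  let ?x = "2 powr (N * r)"
  have x: "?x \<ge> 1" using r by (simp add: ge_one_powr_ge_zero)
  \<comment> \<open>\<open>?x\<close> is at least 1, so rounding up and adding 1 costs at most a
    factor 3.\<close>
  have lo: "?x \<le> codebook_size r N" and up: "codebook_size r N \<le> 3 * ?x"
    using x unfolding codebook_size_def by linarith+
  have "nat \<lceil>?x\<rceil> \<ge> 1" using x by linarith
  then show "codebook_size r N \<ge> 2" by (simp add: codebook_size_def)
  have "N * r \<le> log 2 (codebook_size r N)"
    using lo x by (simp add: le_log_iff)
  then show "N > 0 \<Longrightarrow> log 2 (codebook_size r N) / N \<ge> r" by (simp add: field_simps)
  have "(real (codebook_size r N))\<^sup>2 \<le> (3 * ?x)\<^sup>2" using up by (intro power_mono) auto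
  also have "\<dots> = 9 * (2 powr (2 * r)) ^ N"
    by (simp add: power2_eq_square powr_realpow[symmetric] powr_powr powr_add[symmetric] algebra_simps)
  finally show "(real (codebook_size r N))\<^sup>2 / 3 \<le> 3 * (2 powr (2 * r)) ^ N" by simp
qed

text \<open>Up to a constant the squared codebook size grows by the factor
  \<open>2 powr (2 * r)\<close> per step, and \<open>H ^ N\<close> grows strictly faster.\<close>

lemma codebook_error_tendsto:
  assumes r: "r \<ge> 0" "2 powr (2 * r) < H"
  shows "(\<lambda>N. (real (codebook_size r N))\<^sup>2 / 3 / H ^ N) \<longlonglongrightarrow> 0"
proof (rule tendsto_sandwich[OF _ _ tendsto_const])
  have H: "H > 0" using r(2) by (smt (verit) powr_gt_zero)
  show "\<forall>\<^sub>F N in sequentially. 0 \<le> (real (codebook_size r N))\<^sup>2 / 3 / H ^ N" using H by simp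
  show "\<forall>\<^sub>F N in sequentially. (real (codebook_size r N))\<^sup>2 / 3 / H ^ N \<le> 3 * (2 powr (2 * r) / H) ^ N"
    using divide_right_mono[OF codebook_size(3)[OF r(1)], of "H ^ N" for N] H
    by (intro always_eventually) (simp add: power_divide)
  have "(\<lambda>N. 3 * (2 powr (2 * r) / H) ^ N) \<longlonglongrightarrow> 3 * 0"
    using r H by (intro tendsto_intros LIMSEQ_power_zero) auto
  then show "(\<lambda>N. 3 * (2 powr (2 * r) / H) ^ N) \<longlonglongrightarrow> 0" by simp
qed

text \<open>The given \<open>\<rho>0\<close> is replaced by the possibly larger
  \<open>\<rho>\<close> that meets the bound on \<open>R2\<close> with equality, which keeps the sum
  bound true. Then \<open>G\<close> is exactly \<open>2 powr (2 * R2)\<close>, the remaining factor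
  \<open>H\<close> covers \<open>R1\<close>, and the slack \<epsilon> makes the comparison of growth
  rates strict.\<close>

lemma region_imp_achievable:
  assumes P: "P1 > 0" "P2 > 0" and s: "s > 0" and R: "R1 \<ge> 0" "R2 \<ge> 0" and \<rho>0: "0 \<le> \<rho>0" "\<rho>0 \<le> 1"
    and r2: "R2 \<le> 1/2 * log 2 (1 + P2 * (1 - \<rho>0\<^sup>2) / s)"
    and r12: "R1 + R2 \<le> 1/2 * log 2 (1 + (P1 + P2 + 2 * sqrt (P1 * P2) * \<rho>0) / s)"
  shows "achievable_fb P1 P2 s (R1, R2)"
proof -
  define G where "G = 2 powr (2 * R2)"
  define Q where "Q = s * (G - 1)"
  define \<rho> where "\<rho> = sqrt (1 - Q / P2)"
  have G1: "G \<ge> 1" using R by (simp add: G_def ge_one_powr_ge_zero)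
  have Q: "Q \<ge> 0" using G1 s by (simp add: Q_def)
  have "\<rho>0\<^sup>2 \<le> 1" using \<rho>0 by (simp add: power_le_one)
  then have "1 + P2 * (1 - \<rho>0\<^sup>2) / s > 0" using P s by (intro add_pos_nonneg) auto
  moreover have "2 * R2 \<le> log 2 (1 + P2 * (1 - \<rho>0\<^sup>2) / s)" using r2 by simp
  ultimately have "G \<le> 1 + P2 * (1 - \<rho>0\<^sup>2) / s" unfolding G_def by (simp add: le_log_iff)
  then have "Q \<le> P2 * (1 - \<rho>0\<^sup>2)" using s by (simp add: Q_def field_simps)
  then have "\<rho>0\<^sup>2 \<le> 1 - Q / P2" using P by (simp add: field_simps)
  moreover from order_trans[OF zero_le_power2 this] have "1 - Q / P2 \<ge> 0" .
  ultimately have \<rho>_ge: "\<rho>0 \<le> \<rho>" and \<rho>2: "\<rho>\<^sup>2 = 1 - Q / P2"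
    unfolding \<rho>_def by (simp_all add: real_le_rsqrt)
  have "\<rho> \<le> 1" using Q P by (simp add: \<rho>_def)
  with \<rho>0 \<rho>_ge have \<rho>: "0 \<le> \<rho>" "\<rho> \<le> 1" by linarith+
  \<comment> \<open>The degenerate case: the inner signal vanishes exactly when the second user asks
    for rate 0, where one message suffices.\<close>
  have \<rho>1: "\<rho> = 1 \<longleftrightarrow> R2 = 0"
  proof -
    have "\<rho> = 1 \<longleftrightarrow> Q = 0" using P by (auto simp: \<rho>_def)
    also have "\<dots> \<longleftrightarrow> R2 = 0" using s by (auto simp: Q_def G_def powr_eq_one_iff_gen)
    finally show ?thesis .
  qed
  have G_eq: "G = 1 + P2 * (1 - \<rho>\<^sup>2) / s" unfolding \<rho>2 using P s by (simp add: Q_def field_simps)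
  define S where "S = P1 + P2 + 2 * sqrt (P1 * P2) * \<rho>"
  define H where "H = (1 + S / s) / G"
  have S: "S > 0" using P \<rho> unfolding S_def by (intro add_pos_nonneg) auto
  have GH: "G * H = 1 + (P1 + P2 + 2 * sqrt (P1 * P2) * \<rho>) / s"
    using G1 by (simp add: H_def S_def)
  have "2 powr (2 * R1) * G \<le> 1 + S / s"
  proof -
    have "2 * (R1 + R2) \<le> log 2 (1 + (P1 + P2 + 2 * sqrt (P1 * P2) * \<rho>0) / s)" using r12 by simp
    moreover have "1 + (P1 + P2 + 2 * sqrt (P1 * P2) * \<rho>0) / s > 0"
      using P s \<rho>0 by (intro add_pos_nonneg) auto
    ultimately have "2 powr (2 * (R1 + R2)) \<le> 1 + (P1 + P2 + 2 * sqrt (P1 * P2) * \<rho>0) / s"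
      by (simp add: le_log_iff)
    also have "\<dots> \<le> 1 + S / s"
      unfolding S_def using \<rho>_ge s P by (intro add_left_mono divide_right_mono mult_left_mono) auto
    finally show ?thesis by (simp add: G_def powr_add[symmetric] algebra_simps)
  qed
  then have HR: "2 powr (2 * R1) \<le> H" using G1 by (simp add: H_def field_simps)
  \<comment> \<open>Since \<open>P1 > 0\<close>, the outer factor \<open>H\<close> exceeds 1
    strictly; this serves the case where \<open>R1 - \<epsilon>\<close> is not positive and the
    codebook has rate 0.\<close>
  have "P2 * (1 - \<rho>\<^sup>2) \<le> P2 * 1" using P by (intro mult_left_mono) auto
  then have "P2 * (1 - \<rho>\<^sup>2) < S" using P \<rho> unfolding S_def by (smt (verit) mult_nonneg_nonneg real_sqrt_ge_zero)
  then have "G < 1 + S / s" unfolding G_eq using s by (simp add: divide_strict_right_mono)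
  then have H1: "H > 1" using G1 by (simp add: H_def field_simps)
  have "\<exists>N0. \<forall>N\<ge>N0. N > 0 \<longrightarrow> (\<exists>M1 M2 f1 f2 psi. fb_code P1 P2 s N M1 M2 f1 f2 psi \<and>
        log 2 (real M1) / real N \<ge> R1 - \<epsilon> \<and> log 2 (real M2) / real N \<ge> R2 - \<epsilon> \<and>
        err_prob s N M1 M2 f1 f2 psi \<le> \<epsilon>)" if \<epsilon>: "\<epsilon> > 0" for \<epsilon>
  proof -
    \<comment> \<open>The reduced rates are cut off at 0, since \<open>codebook_size\<close> expects
      a nonnegative rate.\<close>
    define q1 where "q1 = max (R1 - \<epsilon>) 0"
    define q2 where "q2 = max (R2 - \<epsilon>) 0"
    define M2 where "M2 = (\<lambda>N. if \<rho> = 1 then 1 else codebook_size q2 N)"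
    define E2 where "E2 = (\<lambda>N. if \<rho> = 1 then 0 else (real (M2 N))\<^sup>2 / 3 / G ^ N)"
    have q: "q1 \<ge> 0" "q2 \<ge> 0" by (auto simp: q1_def q2_def)
    have "2 powr (2 * q1) < H"
    proof (cases "R1 - \<epsilon> \<le> 0")
      case True then show ?thesis using H1 by (simp add: q1_def)
    next
      case False
      then have "2 powr (2 * q1) < 2 powr (2 * R1)" using \<epsilon> by (simp add: q1_def)
      then show ?thesis using HR by (rule less_le_trans)
    qed
    then have lim1: "(\<lambda>N. (real (codebook_size q1 N))\<^sup>2 / 3 / H ^ N) \<longlonglongrightarrow> 0"
      by (intro codebook_error_tendsto q)
    have lim2: "E2 \<longlonglongrightarrow> 0"
    proof (cases "\<rho> = 1")
      case True then show ?thesis by (simp add: E2_def)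
    next
      case False
      then have "R2 > 0" using \<rho>1 R by simp
      then have "2 powr (2 * q2) < G" using \<epsilon> by (simp add: G_def q2_def)
      then show ?thesis using False codebook_error_tendsto[OF q(2)] by (simp add: E2_def M2_def)
    qed
    from order_tendstoD(2)[OF tendsto_add[OF lim1 lim2], of \<epsilon>] \<epsilon>
    obtain N0 where N0: "\<And>N. N \<ge> N0 \<Longrightarrow> (real (codebook_size q1 N))\<^sup>2 / 3 / H ^ N + E2 N < \<epsilon>"
      by (auto simp: eventually_sequentially)
    show ?thesis
    proof (rule exI[of _ N0], intro allI impI)
      fix N assume N: "N \<ge> N0" "N > 0"
      have M2: "if \<rho> = 1 then M2 N = 1 else M2 N \<ge> 2"
        using codebook_size(1)[OF q(2)] by (simp add: M2_def)
      obtain f1 f2 psi where code: "fb_code P1 P2 s N (codebook_size q1 N) (M2 N) f1 f2 psi"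
        and "err_prob s N (codebook_size q1 N) (M2 N) f1 f2 psi
          \<le> (real (codebook_size q1 N))\<^sup>2 / 3 / H ^ N + (if \<rho> = 1 then 0 else (real (M2 N))\<^sup>2 / 3 / G ^ N)"
        using linear_feedback_code[OF P s \<rho> codebook_size(1)[OF q(1)] M2 G_eq GH] by blast
      then have err: "err_prob s N (codebook_size q1 N) (M2 N) f1 f2 psi \<le> \<epsilon>"
        using N0[OF N(1)] by (simp add: E2_def)
      have "log 2 (codebook_size q1 N) / N \<ge> R1 - \<epsilon>"
        using codebook_size(2)[OF q(1) N(2)] by (simp add: q1_def)
      moreover have "log 2 (M2 N) / N \<ge> R2 - \<epsilon>"
        using codebook_size(2)[OF q(2) N(2)] \<rho>1 \<epsilon> by (simp add: M2_def q2_def)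
      ultimately show "\<exists>M1 M2 f1 f2 psi. fb_code P1 P2 s N M1 M2 f1 f2 psi \<and>
        log 2 (real M1) / real N \<ge> R1 - \<epsilon> \<and> log 2 (real M2) / real N \<ge> R2 - \<epsilon> \<and>
        err_prob s N M1 M2 f1 f2 psi \<le> \<epsilon>"
        using code err by blast
    qed
  qed
  then show ?thesis using R by (simp add: achievable_fb_def)
qed

theorem theorem5:
  fixes P1 P2 s :: real
  assumes "P1 > 0" and "P2 > 0" and "s > 0"
  shows "capacity_fb_gmac_dms P1 P2 s =
    (\<Union>\<rho>\<in>{0..1}. {(R1, R2). R1 \<ge> 0 \<and> R2 \<ge> 0 \<and>
        R2 \<le> 1/2 * log 2 (1 + P2 * (1 - \<rho>\<^sup>2) / s) \<and>
        R1 + R2 \<le> 1/2 * log 2 (1 + (P1 + P2 + 2 * sqrt (P1 * P2) * \<rho>) / s)})"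
proof (intro set_eqI iffI)
  fix R assume "R \<in> capacity_fb_gmac_dms P1 P2 s"
  then have ach: "achievable_fb P1 P2 s (fst R, snd R)"
    by (simp add: capacity_fb_gmac_dms_def)
  then have "fst R \<ge> 0" "snd R \<ge> 0"
    by (simp_all add: achievable_fb_def)
  with achievable_imp_region[OF assms ach]
  show "R \<in> (\<Union>\<rho>\<in>{0..1}. {(R1, R2). R1 \<ge> 0 \<and> R2 \<ge> 0 \<and>
        R2 \<le> 1/2 * log 2 (1 + P2 * (1 - \<rho>\<^sup>2) / s) \<and>
        R1 + R2 \<le> 1/2 * log 2 (1 + (P1 + P2 + 2 * sqrt (P1 * P2) * \<rho>) / s)})"
    by (auto simp: case_prod_beta)
next
  fix R assume "R \<in> (\<Union>\<rho>\<in>{0..1}. {(R1, R2). R1 \<ge> 0 \<and> R2 \<ge> 0 \<and>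
        R2 \<le> 1/2 * log 2 (1 + P2 * (1 - \<rho>\<^sup>2) / s) \<and>
        R1 + R2 \<le> 1/2 * log 2 (1 + (P1 + P2 + 2 * sqrt (P1 * P2) * \<rho>) / s)})"
  then obtain \<rho> where "0 \<le> \<rho>" "\<rho> \<le> 1" "fst R \<ge> 0" "snd R \<ge> 0"
    "snd R \<le> 1/2 * log 2 (1 + P2 * (1 - \<rho>\<^sup>2) / s)"
    "fst R + snd R \<le> 1/2 * log 2 (1 + (P1 + P2 + 2 * sqrt (P1 * P2) * \<rho>) / s)"
    by (auto simp: case_prod_beta)
  then have "achievable_fb P1 P2 s (fst R, snd R)"
    by (intro region_imp_achievable[OF assms])
  then show "R \<in> capacity_fb_gmac_dms P1 P2 s"
    by (simp add: capacity_fb_gmac_dms_def)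
qed

end
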